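(* Let $M_3$ be the 3-hypergraph defined in the context. Then $M_3$ is a countably infinite set-homogeneous 3-hypergraph which is not homogeneous and whose automorphism group is not 2-transitive. Moreover, every countably infinite ${\le}4$-set-homogeneous 3-hypergraph whose automorphism group is not 2-transitive on its vertex set is isomorphic to $M_3$.
   Context: A $k$-hypergraph is a pair $(M,E)$ where $E$ is a set of $k$-element subsets of $M$ (the edges); $k$-subsets not in $E$ are non-edges. Substructures are induced subhypergraphs. All structures considered are countable (finite or countably infinite). A countable structure $M$ is $t$-set-homogeneous if whenever $U,V\subseteq M$ with $|U|=|V|=t$ carry isomorphic induced substructures, there is $g\in\mathrm{Aut}(M)$ with $U^g=V$; it is ${\le}t$-set-homogeneous if it is $s$-set-homogeneous for all $1\le s\le t$, and set-homogeneous if it is $t$-set-homogeneous for all $t\ge 1$. It is homogeneous if every isomorphism between finite induced substructures extends to an automorphism. A permutation group is $2$-transitive if it is transitive on ordered pairs of distinct points. A $C$-relation on a set $M$ is a ternary relation $C$ satisfying, for all $x,y,z,w\in M$: (C1) $C(x;y,z)\to C(x;z,y)$; (C2) $C(x;y,z)\to\neg C(y;x,z)$; (C3) $C(x;y,z)\to (C(x;w,z)\vee C(w;y,z))$; (C4) $x\ne y\to C(x;y,y)$; (C5) $\exists x\, C(x;y,z)$; (C6) $x\ne y\to\exists z(y\ne z\wedge C(x;y,z))$. Call it 2-regular if for all distinct $x,y,z$ at least one of $C(x;y,z),C(y;x,z),C(z;x,y)$ holds. A total order $\le$ on $M$ is compatible with $C$ if $x<y<z$ implies $C(x;y,z)\vee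 C(z;x,y)$. Strong density means: $\le$ is dense without endpoints, and (C8) whenever $C(x;y,z)$ there exist $w_1,w_2$ with $C(w_1;y,z)\wedge C(x;y,w_1)\wedge w_1<\min\{y,z\}$ and $C(w_2;y,z)\wedge C(x;y,w_2)\wedge \max\{y,z\}<w_2$. There is, up to isomorphism, a unique countably infinite structure $(M,C,\le)$ with $C$ a 2-regular $C$-relation satisfying (C1)–(C6), $\le$ a compatible total order, and strong density; it is homogeneous in the language $\{C,\le\}$. $M_3=(M,E)$ is the 3-hypergraph on this $M$ whose edges are the 3-sets $\{x,y,z\}$ of distinct elements with $x<y$, $x<z$ and $C(x;y,z)$. *)

theory Defs
  imports Main "HOL-Library.Countable_Set"
begin

definition hypergraph :: "nat \<Rightarrow> 'a set \<Rightarrow> 'a set set \<Rightarrow> bool" where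
  "hypergraph k V E \<longleftrightarrow> (\<forall>A\<in>E. A \<subseteq> V \<and> finite A \<and> card A = k)"

definition induced_iso :: "'a set \<Rightarrow> 'a set set \<Rightarrow> 'a set \<Rightarrow> 'a set \<Rightarrow> ('a \<Rightarrow> 'a) \<Rightarrow> bool" where
  "induced_iso V E U U' h \<longleftrightarrow> U \<subseteq> V \<and> U' \<subseteq> V \<and> bij_betw h U U' \<and>
     (\<forall>A. A \<subseteq> U \<longrightarrow> (A \<in> E \<longleftrightarrow> h ` A \<in> E))"

definition hg_aut :: "'a set \<Rightarrow> 'a set set \<Rightarrow> ('a \<Rightarrow> 'a) \<Rightarrow> bool" where
  "hg_aut V E g \<longleftrightarrow> bij_betw g V V \<and> (\<forall>A. A \<subseteq> V \<longrightarrow> (A \<in> E \<longleftrightarrow> g ` A \<in> E))"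

definition t_set_homogeneous :: "nat \<Rightarrow> 'a set \<Rightarrow> 'a set set \<Rightarrow> bool" where
  "t_set_homogeneous t V E \<longleftrightarrow>
     (\<forall>U U'. U \<subseteq> V \<and> U' \<subseteq> V \<and> finite U \<and> finite U' \<and> card U = t \<and> card U' = t \<and>
        (\<exists>h. induced_iso V E U U' h) \<longrightarrow> (\<exists>g. hg_aut V E g \<and> g ` U = U'))"

definition le_set_homogeneous :: "nat \<Rightarrow> 'a set \<Rightarrow> 'a set set \<Rightarrow> bool" where
  "le_set_homogeneous t V E \<longleftrightarrow> (\<forall>s. 1 \<le> s \<and> s \<le> t \<longrightarrow> t_set_homogeneous s V E)"

definition set_homogeneous :: "'a set \<Rightarrow> 'a set set \<Rightarrow> bool" where
  "set_homogeneous V E \<longleftrightarrow> (\<forall>t\<ge>1. t_set_homogeneous t V E)"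

definition homogeneous :: "'a set \<Rightarrow> 'a set set \<Rightarrow> bool" where
  "homogeneous V E \<longleftrightarrow>
     (\<forall>U U' h. finite U \<and> induced_iso V E U U' h \<longrightarrow>
        (\<exists>g. hg_aut V E g \<and> (\<forall>x\<in>U. g x = h x)))"

definition aut_two_transitive :: "'a set \<Rightarrow> 'a set set \<Rightarrow> bool" where
  "aut_two_transitive V E \<longleftrightarrow>
     (\<forall>x\<in>V. \<forall>y\<in>V. \<forall>x'\<in>V. \<forall>y'\<in>V. x \<noteq> y \<and> x' \<noteq> y' \<longrightarrow>
        (\<exists>g. hg_aut V E g \<and> g x = x' \<and> g y = y'))"

definition hg_isomorphic :: "'a set \<Rightarrow> 'a set set \<Rightarrow> 'b set \<Rightarrow> 'b set set \<Rightarrow> bool" where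
  "hg_isomorphic V E W F \<longleftrightarrow>
     (\<exists>f. bij_betw f V W \<and> (\<forall>A. A \<subseteq> V \<longrightarrow> (A \<in> E \<longleftrightarrow> f ` A \<in> F)))"

definition C_relation :: "'a set \<Rightarrow> ('a \<Rightarrow> 'a \<Rightarrow> 'a \<Rightarrow> bool) \<Rightarrow> bool" where
  "C_relation M C \<longleftrightarrow>
     (\<forall>x\<in>M. \<forall>y\<in>M. \<forall>z\<in>M. C x y z \<longrightarrow> C x z y) \<and>
     (\<forall>x\<in>M. \<forall>y\<in>M. \<forall>z\<in>M. C x y z \<longrightarrow> \<not> C y x z) \<and>
     (\<forall>x\<in>M. \<forall>y\<in>M. \<forall>z\<in>M. \<forall>w\<in>M. C x y z \<longrightarrow> C x w z \<or> C w y z) \<and>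
     (\<forall>x\<in>M. \<forall>y\<in>M. x \<noteq> y \<longrightarrow> C x y y) \<and>
     (\<forall>y\<in>M. \<forall>z\<in>M. \<exists>x\<in>M. C x y z) \<and>
     (\<forall>x\<in>M. \<forall>y\<in>M. x \<noteq> y \<longrightarrow> (\<exists>z\<in>M. y \<noteq> z \<and> C x y z))"

definition C_two_regular :: "'a set \<Rightarrow> ('a \<Rightarrow> 'a \<Rightarrow> 'a \<Rightarrow> bool) \<Rightarrow> bool" where
  "C_two_regular M C \<longleftrightarrow>
     (\<forall>x\<in>M. \<forall>y\<in>M. \<forall>z\<in>M. x \<noteq> y \<and> x \<noteq> z \<and> y \<noteq> z \<longrightarrow> C x y z \<or> C y x z \<or> C z x y)"

definition total_order_on :: "'a set \<Rightarrow> ('a \<Rightarrow> 'a \<Rightarrow> bool) \<Rightarrow> bool" where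
  "total_order_on M le \<longleftrightarrow>
     (\<forall>x\<in>M. le x x) \<and>
     (\<forall>x\<in>M. \<forall>y\<in>M. le x y \<and> le y x \<longrightarrow> x = y) \<and>
     (\<forall>x\<in>M. \<forall>y\<in>M. \<forall>z\<in>M. le x y \<and> le y z \<longrightarrow> le x z) \<and>
     (\<forall>x\<in>M. \<forall>y\<in>M. le x y \<or> le y x)"

definition strict :: "('a \<Rightarrow> 'a \<Rightarrow> bool) \<Rightarrow> 'a \<Rightarrow> 'a \<Rightarrow> bool" where
  "strict le x y \<longleftrightarrow> le x y \<and> x \<noteq> y"

definition compatible_order :: "'a set \<Rightarrow> ('a \<Rightarrow> 'a \<Rightarrow> 'a \<Rightarrow> bool) \<Rightarrow> ('a \<Rightarrow> 'a \<Rightarrow> bool) \<Rightarrow> bool" where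
  "compatible_order M C le \<longleftrightarrow>
     (\<forall>x\<in>M. \<forall>y\<in>M. \<forall>z\<in>M. strict le x y \<and> strict le y z \<longrightarrow> C x y z \<or> C z x y)"

definition strongly_dense :: "'a set \<Rightarrow> ('a \<Rightarrow> 'a \<Rightarrow> 'a \<Rightarrow> bool) \<Rightarrow> ('a \<Rightarrow> 'a \<Rightarrow> bool) \<Rightarrow> bool" where
  "strongly_dense M C le \<longleftrightarrow>
     (\<forall>x\<in>M. \<forall>y\<in>M. strict le x y \<longrightarrow> (\<exists>z\<in>M. strict le x z \<and> strict le z y)) \<and>
     (\<forall>x\<in>M. \<exists>y\<in>M. strict le x y) \<and>
     (\<forall>x\<in>M. \<exists>y\<in>M. strict le y x) \<and>
     (\<forall>x\<in>M. \<forall>y\<in>M. \<forall>z\<in>M. C x y z \<longrightarrow>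
        (\<exists>w1\<in>M. C w1 y z \<and> C x y w1 \<and> strict le w1 y \<and> strict le w1 z) \<and>
        (\<exists>w2\<in>M. C w2 y z \<and> C x y w2 \<and> strict le y w2 \<and> strict le z w2))"

text \<open>The defining conditions of the (unique up to isomorphism) countably infinite structure (M,C,\<le>).\<close>
definition M3_structure :: "'a set \<Rightarrow> ('a \<Rightarrow> 'a \<Rightarrow> 'a \<Rightarrow> bool) \<Rightarrow> ('a \<Rightarrow> 'a \<Rightarrow> bool) \<Rightarrow> bool" where
  "M3_structure M C le \<longleftrightarrow> countable M \<and> infinite M \<and>
     C_relation M C \<and> C_two_regular M C \<and> total_order_on M le \<and>
     compatible_order M C le \<and> strongly_dense M C le"

definition M3_edges :: "'a set \<Rightarrow> ('a \<Rightarrow> 'a \<Rightarrow> 'a \<Rightarrow> bool) \<Rightarrow> ('a \<Rightarrow> 'a \<Rightarrow> bool) \<Rightarrow> 'a set set" where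
  "M3_edges M C le = {{x, y, z} | x y z. x \<in> M \<and> y \<in> M \<and> z \<in> M \<and>
      x \<noteq> y \<and> x \<noteq> z \<and> y \<noteq> z \<and> strict le x y \<and> strict le x z \<and> C x y z}"

end

theory Submission
  imports Defs
begin

text \<open>
  For finite subsets of M, the structure (C, le) is a plane binary tree: the edges are the triples whose
  leftmost leaf branches off first. A set U of at least two leaves splits at its root into a left part L
  and a right part R such that triples meeting L in one point are edges and triples meeting L in two
  points are not. Two partitions of U with this property can differ only by exchanging one
  vertex of L with one of R, and this exchange preserves the edges inside each part. By induction, isomorphic
  finite subhypergraphs carry isomorphic trees, and set-homogeneity follows from the homogeneity of
  (M, C, le). A two-against-two split of four points makes the order definable from the edges, so no
  automorphism swaps two points.

  Conversely, if the automorphism group is transitive on unordered but not on ordered pairs, it preserves a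
  tournament T. Suppose that T is a linear order. Four-point sets with equally many edges lie in one orbit, so
  each number of edges is realised by at most one pattern of a sorted quadruple; on the other hand two
  triples sharing only a pair can be prescribed independently. Only the five patterns of M3 and their
  reversals satisfy both conditions, and these patterns are the axioms of a C-relation.
  If T has a 3-cycle, then the edges are the cyclic triples or the others. Counting
  edges in quadruples, no vertex dominates, or is dominated by, a 3-cycle, and T is the
  dense local order. That tournament has an anti-automorphism, which preserves the edges but
  reverses T, a contradiction.
\<close>

section \<open>Back and forth\<close>

text \<open>Set-homogeneity yields automorphisms that match finite sets, without control over single
  points. Two observations make them usable. They preserve \<open>T\<close>, so between sets that
  \<open>T\<close> orders linearly they match points by rank. And a 3-hypergraph on four points is
  determined up to isomorphism by its number of edges, because each of its triples is named by the
  point it omits. Four points are also enough to rebuild M3: no axiom of a C-relation speaks of more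
  than four points, and each witness asked for by strong density forms a quadruple with the given
  triple. For tournaments with 3-cycles the contradiction comes from a symmetry of the whole
  structure: seen from one vertex, the others form the rational line in two dense colours, which is
  isomorphic to its own reversal with the colours exchanged.\<close>

lemma finite_maximal:
  assumes "finite A" "A \<noteq> {}" "\<And>x. x \<in> A \<Longrightarrow> \<not> R x x"
    and "\<And>x y z. x \<in> A \<Longrightarrow> y \<in> A \<Longrightarrow> z \<in> A \<Longrightarrow> R x y \<Longrightarrow> R y z \<Longrightarrow> R x z"
  shows "\<exists>m\<in>A. \<forall>x\<in>A. \<not> R m x"
proof -
  have "asymp_on A R" using assms(3,4) by (metis asymp_onI)
  moreover have "transp_on A R" using assms(4) by (metis transp_onI)
  ultimately show ?thesis
    using Finite_Set.bex_max_element[of A R] assms(1-3) by metis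
qed

text \<open>Every finite part of \<open>f\<close> lies inside a member of \<open>P\<close> above
  \<open>p0\<close>. Hence relations of any finite arity that the members of \<open>P\<close>
  respect pass to \<open>f\<close>, and \<open>f\<close> extends \<open>p0\<close>, whatever
  structure is at hand.\<close>

lemma back_and_forth:
  fixes P :: "('a \<times> 'b) set set"
  assumes "countable A" "countable B" "p0 \<in> P"
    and sub: "\<And>p. p \<in> P \<Longrightarrow> p \<subseteq> A \<times> B"
    and inj: "\<And>p x y x' y'. p \<in> P \<Longrightarrow> (x, x') \<in> p \<Longrightarrow> (y, y') \<in> p \<Longrightarrow> x = y \<longleftrightarrow> x' = y'"
    and forward: "\<And>p a. p \<in> P \<Longrightarrow> a \<in> A \<Longrightarrow> \<exists>b. insert (a, b) p \<in> P"
    and backward: "\<And>p b. p \<in> P \<Longrightarrow> b \<in> B \<Longrightarrow> \<exists>a. insert (a, b) p \<in> P"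
  obtains f where "bij_betw f A B"
    "\<And>S. finite S \<Longrightarrow> S \<subseteq> A \<Longrightarrow> \<exists>p\<in>P. p0 \<subseteq> p \<and> (\<forall>x\<in>S. (x, f x) \<in> p)"
proof -
  \<comment> \<open>One stage treats the \<open>n\<close>-th element of both enumerations. The
    membership tests cover empty \<open>A\<close> or \<open>B\<close>, where
    \<open>from_nat_into\<close> returns an arbitrary value.\<close>
  have step: "\<exists>q. q \<in> P \<and> p \<subseteq> q \<and> (from_nat_into A n \<in> A \<longrightarrow> from_nat_into A n \<in> Domain q) \<and>
      (from_nat_into B n \<in> B \<longrightarrow> from_nat_into B n \<in> Range q)" if p: "p \<in> P" for p n
  proof -
    obtain q where q: "q \<in> P" "p \<subseteq> q" "from_nat_into A n \<in> A \<longrightarrow> from_nat_into A n \<in> Domain q"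
      using p forward[OF p, of "from_nat_into A n"] by (cases "from_nat_into A n \<in> A") blast+
    obtain r where "r \<in> P" "q \<subseteq> r" "from_nat_into B n \<in> B \<longrightarrow> from_nat_into B n \<in> Range r"
      using q(1) backward[OF q(1), of "from_nat_into B n"] by (cases "from_nat_into B n \<in> B") blast+
    with q show ?thesis by (meson Domain_mono subset_iff)
  qed
  have "\<exists>c. \<forall>n. ((n = 0 \<longrightarrow> c n = p0) \<and> c n \<in> P) \<and> c n \<subseteq> c (Suc n) \<and>
      (from_nat_into A n \<in> A \<longrightarrow> from_nat_into A n \<in> Domain (c (Suc n))) \<and>
      (from_nat_into B n \<in> B \<longrightarrow> from_nat_into B n \<in> Range (c (Suc n)))"
    by (rule dependent_nat_choice) (use step assms(3) in auto)
  then obtain c where c: "c 0 = p0" "\<And>n. c n \<in> P" "\<And>n. c n \<subseteq> c (Suc n)"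
    "\<And>n. from_nat_into A n \<in> A \<Longrightarrow> from_nat_into A n \<in> Domain (c (Suc n))"
    "\<And>n. from_nat_into B n \<in> B \<Longrightarrow> from_nat_into B n \<in> Range (c (Suc n))"
    by blast
  have mono: "c m \<subseteq> c n" if "m \<le> n" for m n
    using lift_Suc_mono_le[of c, OF c(3) that] .
  define Q where "Q = (\<Union>n. c n)"
  have inQ: "x \<in> A \<and> y \<in> B" if "(x, y) \<in> Q" for x y
    using that sub[OF c(2)] unfolding Q_def by blast
  have injQ: "x = y \<longleftrightarrow> x' = y'" if xy: "(x, x') \<in> Q" "(y, y') \<in> Q" for x y x' y'
  proof -
    obtain m n where "(x, x') \<in> c m" "(y, y') \<in> c n" using xy unfolding Q_def by blast
    then have "(x, x') \<in> c (max m n)" "(y, y') \<in> c (max m n)"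
      using mono[of m "max m n"] mono[of n "max m n"] by auto
    then show ?thesis using inj[OF c(2)] by blast
  qed
  have domQ: "\<exists>y. (x, y) \<in> Q" if x: "x \<in> A" for x
  proof -
    obtain n where "from_nat_into A n = x"
      using from_nat_into_surj[OF assms(1) x] by blast
    then show ?thesis using c(4)[of n] x unfolding Q_def by blast
  qed
  have ranQ: "\<exists>x. (x, y) \<in> Q" if y: "y \<in> B" for y
  proof -
    obtain n where "from_nat_into B n = y"
      using from_nat_into_surj[OF assms(2) y] by blast
    then show ?thesis using c(5)[of n] y unfolding Q_def by blast
  qed
  define f where "f x = (SOME y. (x, y) \<in> Q)" for x
  have f: "(x, f x) \<in> Q" if "x \<in> A" for x
    unfolding f_def using someI_ex[OF domQ[OF that]] .
  show thesis
  proof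
    show "bij_betw f A B"
    proof (intro bij_betwI')
      show "f x = f y \<longleftrightarrow> x = y" if "x \<in> A" "y \<in> A" for x y
        using injQ[OF f[OF that(1)] f[OF that(2)]] by blast
      show "f x \<in> B" if "x \<in> A" for x
        using inQ f[OF that] by blast
      show "\<exists>x\<in>A. y = f x" if "y \<in> B" for y
        using ranQ[OF that] f inQ injQ by metis
    qed
    show "\<exists>p\<in>P. p0 \<subseteq> p \<and> (\<forall>x\<in>S. (x, f x) \<in> p)" if "finite S" "S \<subseteq> A" for S
    proof -
      have "\<exists>n. \<forall>x\<in>S. (x, f x) \<in> c n"
        using that
      proof (induction S rule: finite_induct)
        case (insert x S)
        obtain m where "\<forall>x\<in>S. (x, f x) \<in> c m" using insert by auto
        moreover obtain n where "(x, f x) \<in> c n"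
          using f insert.prems unfolding Q_def by blast
        ultimately have "\<forall>y\<in>insert x S. (y, f y) \<in> c (max m n)"
          using mono[of m "max m n"] mono[of n "max m n"] by auto
        then show ?case by blast
      qed simp
      then show ?thesis using c(1,2) mono[of 0] by (metis le0)
    qed
  qed
qed

section \<open>Plane C-relations\<close>

text \<open>Points are leaves of a tree, and \<open>C x y z\<close> says that the path to
  \<open>x\<close> leaves those to \<open>y\<close> and \<open>z\<close> before these two
  part.\<close>

locale C_structure =
  fixes M :: "'a set" and C :: "'a \<Rightarrow> 'a \<Rightarrow> 'a \<Rightarrow> bool" and le :: "'a \<Rightarrow> 'a \<Rightarrow> bool"
  assumes M3: "M3_structure M C le"
begin

abbreviation lt where "lt \<equiv> strict le"
abbreviation E where "E \<equiv> M3_edges M C le"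

lemma countable_M: "countable M" and infinite_M: "infinite M"
  using M3 unfolding M3_structure_def by blast+

lemma C_relation: "C_relation M C"
  using M3 unfolding M3_structure_def by blast

lemma C_sym: "\<lbrakk>x \<in> M; y \<in> M; z \<in> M; C x y z\<rbrakk> \<Longrightarrow> C x z y"
  using C_relation unfolding C_relation_def by (elim conjE) metis

lemma C_asym: "\<lbrakk>x \<in> M; y \<in> M; z \<in> M; C x y z\<rbrakk> \<Longrightarrow> \<not> C y x z"
  using C_relation unfolding C_relation_def by (elim conjE) metis

lemma C_third: "\<lbrakk>x \<in> M; y \<in> M; z \<in> M; w \<in> M; C x y z\<rbrakk> \<Longrightarrow> C x w z \<or> C w y z"
  using C_relation unfolding C_relation_def by (elim conjE) metis

lemma C_pair: "\<lbrakk>x \<in> M; y \<in> M; x \<noteq> y\<rbrakk> \<Longrightarrow> C x y y"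
  using C_relation unfolding C_relation_def by (elim conjE) metis

lemma C_above: "\<lbrakk>y \<in> M; z \<in> M\<rbrakk> \<Longrightarrow> \<exists>x\<in>M. C x y z"
  using C_relation unfolding C_relation_def by (elim conjE) metis

lemma C_cases: "\<lbrakk>x \<in> M; y \<in> M; z \<in> M; x \<noteq> y; x \<noteq> z; y \<noteq> z\<rbrakk> \<Longrightarrow> C x y z \<or> C y x z \<or> C z x y"
  using M3 unfolding M3_structure_def C_two_regular_def by blast

lemma C_neq: "\<lbrakk>x \<in> M; y \<in> M; z \<in> M; C x y z\<rbrakk> \<Longrightarrow> x \<noteq> y \<and> x \<noteq> z"
  using C_asym C_sym by metis

text \<open>For fixed \<open>x\<close>, this makes \<open>C x\<close> an equivalence relation on the
  remaining points; its classes are the branches seen from \<open>x\<close>. A failure would give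
  both \<open>C y z w\<close> and \<open>C w z y\<close>, which \<open>C_asym\<close>
  forbids.\<close>

lemma C_trans: "\<lbrakk>x \<in> M; y \<in> M; z \<in> M; w \<in> M; C x y z; C x z w\<rbrakk> \<Longrightarrow> C x y w"
  using C_third C_sym C_asym by metis

lemma C_excl: "\<lbrakk>x \<in> M; y \<in> M; z \<in> M; C x y z\<rbrakk> \<Longrightarrow> \<not> C y x z \<and> \<not> C z x y \<and> \<not> C y z x \<and> \<not> C z y x"
  using C_asym C_sym by metis

lemma lt_irrefl [simp]: "\<not> lt x x"
  by (simp add: strict_def)

lemma lt_trans: "\<lbrakk>x \<in> M; y \<in> M; z \<in> M; lt x y; lt y z\<rbrakk> \<Longrightarrow> lt x z"
  and lt_cases: "\<lbrakk>x \<in> M; y \<in> M; x \<noteq> y\<rbrakk> \<Longrightarrow> lt x y \<or> lt y x"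
  and lt_asym: "\<lbrakk>x \<in> M; y \<in> M; lt x y\<rbrakk> \<Longrightarrow> \<not> lt y x"
  using M3 unfolding M3_structure_def total_order_on_def strict_def by metis+

lemma lt_neq: "lt x y \<Longrightarrow> x \<noteq> y"
  by (simp add: strict_def)

lemma compatible: "\<lbrakk>x \<in> M; y \<in> M; z \<in> M; lt x y; lt y z\<rbrakk> \<Longrightarrow> C x y z \<or> C z x y"
  using M3 unfolding M3_structure_def compatible_order_def by blast

text \<open>If \<open>x\<close> lay between \<open>y\<close> and \<open>z\<close>, compatibility
  would let one of these branch off first, against \<open>C x y z\<close>. So each branch seen from
  a point lies entirely to its left or to its right.\<close>

lemma C_side: "\<lbrakk>x \<in> M; y \<in> M; z \<in> M; C x y z\<rbrakk> \<Longrightarrow> lt x y \<longleftrightarrow> lt x z"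
  using compatible C_excl lt_cases lt_asym C_neq by metis

lemma C_side': "\<lbrakk>x \<in> M; y \<in> M; z \<in> M; C x y z\<rbrakk> \<Longrightarrow> lt y x \<longleftrightarrow> lt z x"
  using C_side C_neq lt_cases lt_asym by metis

lemma C_dense_left: "\<lbrakk>x \<in> M; y \<in> M; z \<in> M; C x y z\<rbrakk> \<Longrightarrow> \<exists>w\<in>M. C w y z \<and> C x y w \<and> lt w y \<and> lt w z"
  and C_dense_right: "\<lbrakk>x \<in> M; y \<in> M; z \<in> M; C x y z\<rbrakk> \<Longrightarrow> \<exists>w\<in>M. C w y z \<and> C x y w \<and> lt y w \<and> lt z w"
  using M3 unfolding M3_structure_def strongly_dense_def by blast+

text \<open>The leftmost point is determined by the set, so passing to unordered triples loses only
  the order of the last two arguments, which \<open>C_sym\<close> makes harmless.\<close>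

lemma edge_iff:
  assumes "x \<in> M" "y \<in> M" "z \<in> M" "lt x y" "lt x z" "y \<noteq> z"
  shows "{x, y, z} \<in> E \<longleftrightarrow> C x y z"
proof
  assume "C x y z"
  with assms show "{x, y, z} \<in> E" unfolding M3_edges_def using lt_neq by blast
next
  assume "{x, y, z} \<in> E"
  then obtain a b c where abc: "{x, y, z} = {a, b, c}" "a \<in> M" "b \<in> M" "c \<in> M" "lt a b" "lt a c" "C a b c"
    unfolding M3_edges_def by blast
  have "x = a" using abc assms lt_asym lt_neq by (metis insert_iff singletonD)
  moreover have "y = b \<and> z = c \<or> y = c \<and> z = b"
    using abc(1) assms(4-6) abc(5,6) \<open>x = a\<close> unfolding strict_def by auto
  ultimately show "C x y z" using abc C_sym by blast
qed

end

section \<open>Branches of the tree spanned by a finite set\<close>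

context C_structure
begin

text \<open>The paths to \<open>y\<close> and \<open>z\<close> part at the root of the tree spanned
  by \<open>N\<close>, so this single pair can stand for the whole of \<open>N\<close>.\<close>

lemma C_far_point:
  assumes "finite N" "N \<subseteq> M" "y \<in> N"
  obtains z where "z \<in> N" "\<forall>u\<in>N. \<not> C u y z"
proof -
  have "\<exists>z\<in>N. \<forall>u\<in>N. \<not> C u y z"
  proof (rule finite_maximal)
    show "\<not> C x y x" if "x \<in> N" for x
      using that assms C_neq by blast
    show "C c y a" if "a \<in> N" "b \<in> N" "c \<in> N" "C b y a" "C c y b" for a b c
    proof -
      have m: "a \<in> M" "b \<in> M" "c \<in> M" "y \<in> M" using that assms by blast+
      have "C c a b \<or> C a y b" using C_third m that by blast
      moreover have "\<not> C a y b" using C_excl m that by blast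
      ultimately show ?thesis using C_trans[OF m(3) m(4) m(2) m(1)] C_sym m that by blast
    qed
  qed (use assms in auto)
  then show thesis using that by blast
qed

text \<open>\<open>C x y w\<close> says that \<open>w\<close> is strictly closer to \<open>y\<close>
  than \<open>x\<close> is; a closest point is a maximal element of this relation.\<close>

lemma C_nearest_point:
  assumes "finite W" "W \<subseteq> M" "W \<noteq> {}" "y \<in> M"
  obtains x where "x \<in> W" "\<forall>w\<in>W. \<not> C x y w"
proof -
  have "\<exists>x\<in>W. \<forall>w\<in>W. \<not> C x y w"
  proof (rule finite_maximal)
    show "\<not> C x y x" if "x \<in> W" for x
      using that assms C_neq by blast
    show "C a y c" if "a \<in> W" "b \<in> W" "c \<in> W" "C a y b" "C b y c" for a b c
    proof -
      have m: "a \<in> M" "b \<in> M" "c \<in> M" "y \<in> M" using that assms by blast+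
      have "C a c b \<or> C c y b" using C_third m that by blast
      moreover have "\<not> C c y b" using C_excl m that by blast
      ultimately show ?thesis using C_trans[OF m(1) m(4) m(2) m(3)] C_sym m that by blast
    qed
  qed (use assms in auto)
  then show thesis using that by blast
qed

text \<open>By \<open>C_third\<close>, a point \<open>u\<close> outside the branch of
  \<open>y\<close> seen from \<open>b\<close> would satisfy \<open>C u y z\<close>, which the choice
  of \<open>z\<close> excludes for points of \<open>N\<close>.\<close>

lemma C_all_near:
  assumes "N \<subseteq> M" "y \<in> N" "z \<in> N" "\<forall>u\<in>N. \<not> C u y z" "b \<in> M" "C b y z" "u \<in> N" "v \<in> N"
  shows "C b u v"
proof -
  have *: "C b u y" if "u \<in> N" for u
    using assms(1-6) that C_third[of b z y u] C_sym by blast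
  show ?thesis
    using *[OF assms(7)] *[OF assms(8)] assms C_trans[of b u y v] C_sym[of b v y] by blast
qed

text \<open>The separation hypothesis makes \<open>N\<close> the leaf set of a subtree of
  \<open>U\<close>. Strong density, applied to a pair spanning \<open>N\<close> and an outside point
  closest to it, subdivides the edge above that subtree and grows a new leaf \<open>b\<close> on the
  prescribed side \<open>s\<close>.\<close>

lemma branch_exists:
  assumes "finite U" "U \<subseteq> M" "N \<subseteq> U" "N \<noteq> {}"
    and sep: "\<And>w u v. w \<in> U - N \<Longrightarrow> u \<in> N \<Longrightarrow> v \<in> N \<Longrightarrow> C w u v"
  obtains b where "b \<in> M" "\<forall>u\<in>N. lt b u \<longleftrightarrow> s" "\<forall>u\<in>N. \<forall>v\<in>N. C b u v" "\<forall>w\<in>U - N. \<forall>u\<in>N. C w b u"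
proof -
  obtain y where y: "y \<in> N" using assms by blast
  obtain z where z: "z \<in> N" "\<forall>u\<in>N. \<not> C u y z"
    using C_far_point[OF finite_subset[OF assms(3,1)] subset_trans[OF assms(3,2)] y] .
  have m: "y \<in> M" "z \<in> M" using y z assms by blast+
  \<comment> \<open>For \<open>N = U\<close> nothing lies outside, and \<open>C_above\<close>
    supplies a point beyond the root.\<close>
  obtain x where x: "x \<in> M" "C x y z" "\<forall>w\<in>U - N. \<not> C x y w"
  proof (cases "U - N = {}")
    case True
    then show thesis using that C_above[OF m] by blast
  next
    case False
    obtain x where "x \<in> U - N" "\<forall>w\<in>U - N. \<not> C x y w"
      using C_nearest_point[of "U - N" y] False m assms by blast
    then show thesis using that sep y z assms(2) by blast
  qed
  obtain b where b: "b \<in> M" "C b y z" "C x y b" "lt b y \<longleftrightarrow> s"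
    using C_dense_left[OF x(1) m x(2)] C_dense_right[OF x(1) m x(2)] lt_asym m(1) by (cases s) blast+
  have near: "C b u v" if "u \<in> N" "v \<in> N" for u v
    using C_all_near[of N y z b u v] that assms y z b by blast
  show thesis
  proof
    show "\<forall>u\<in>N. lt b u \<longleftrightarrow> s"
      using near[OF y] C_side b(1,4) m(1) assms(2,3) by blast
    show "\<forall>w\<in>U - N. \<forall>u\<in>N. C w b u"
    proof (intro ballI)
      fix w u assume wu: "w \<in> U - N" "u \<in> N"
      then have wm: "w \<in> M" "u \<in> M" using assms by blast+
      have "C x w b \<or> C w y b" using C_third[OF x(1) m(1) b(1) wm(1) b(3)] .
      \<comment> \<open>Otherwise \<open>w\<close> would lie in the branch of \<open>y\<close> seen
        from \<open>x\<close>, hence closer to \<open>y\<close> than the closest point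
        \<open>x\<close>.\<close>
      moreover have "\<not> C x w b"
        using C_trans[OF x(1) m(1) b(1) wm(1) b(3)] C_sym x wm wu b by blast
      ultimately have "C w b y" using C_sym wm m b by blast
      then show "C w b u" using C_trans[OF wm(1) b(1) m(1) wm(2)] sep[OF wu(1) y wu(2)] by blast
    qed
  qed (use b near in auto)
qed

text \<open>The point a branches off the edge of the tree of U directly above the subtree with leaf set N.\<close>

lemma branch_position:
  assumes "finite U" "U \<subseteq> M" "U \<noteq> {}" "a \<in> M" "a \<notin> U"
  obtains N where "N \<subseteq> U" "N \<noteq> {}" "\<forall>u\<in>N. \<forall>v\<in>N. C a u v" "\<forall>w\<in>U - N. \<forall>u\<in>N. C w a u"
proof -
  \<comment> \<open>The points of \<open>U\<close> closest to \<open>a\<close>: none branches off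
    the path to \<open>a\<close> later than these.\<close>
  define N where "N = {u \<in> U. \<forall>w\<in>U. \<not> C u a w}"
  show thesis
  proof
    show "N \<subseteq> U" unfolding N_def by blast
    obtain x where "x \<in> U" "\<forall>w\<in>U. \<not> C x a w" using C_nearest_point[of U a] assms by blast
    then show "N \<noteq> {}" unfolding N_def by blast
    show "\<forall>u\<in>N. \<forall>v\<in>N. C a u v"
    proof (intro ballI)
      fix u v assume "u \<in> N" "v \<in> N"
      then have uv: "u \<in> M" "v \<in> M" "u \<noteq> a" "v \<noteq> a" "\<not> C u a v" "\<not> C v a u"
        using assms unfolding N_def by blast+
      then show "C a u v"
        using C_cases[of a u v] C_pair[of a u] C_sym[of v u a] C_sym[of u v a] assms by metis
    qed
    show "\<forall>w\<in>U - N. \<forall>u\<in>N. C w a u"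
    proof (intro ballI)
      fix w u assume wu: "w \<in> U - N" "u \<in> N"
      then obtain v where v: "v \<in> U" "C w a v" unfolding N_def by blast
      have m: "w \<in> M" "u \<in> M" "v \<in> M" using wu v assms unfolding N_def by blast+
      have "\<not> C u a v" using wu v unfolding N_def by blast
      then have "C w v u" using C_third[OF m(1) assms(4) m(3) m(2) v(2)] C_sym m by blast
      then show "C w a u" using C_trans[OF m(1) assms(4) m(3) m(2) v(2)] by blast
    qed
  qed
qed

context
  fixes U N :: "'a set" and a n :: 'a
  assumes U: "U \<subseteq> M" "N \<subseteq> U" "a \<in> M" "a \<notin> U" "n \<in> N"
    and inside: "\<forall>u\<in>N. \<forall>v\<in>N. C a u v" and outside: "\<forall>w\<in>U - N. \<forall>u\<in>N. C w a u"
begin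

text \<open>Each \<open>w\<close> in \<open>U - N\<close> sees \<open>a\<close> and the
  representative \<open>n\<close> in one branch, so there \<open>a\<close> behaves like
  \<open>n\<close>; on \<open>N\<close> itself \<open>inside\<close> decides. This and the next two
  lemmas express all relations between \<open>a\<close> and \<open>U\<close> through
  \<open>N\<close>, the side of \<open>a\<close> and relations on \<open>U\<close>, so that a point
  branching off in the same way satisfies the same ones.\<close>

lemma branch_C_first:
  assumes "y \<in> U" "z \<in> U"
  shows "C a y z \<longleftrightarrow> y = z \<or> (y \<in> N \<and> z \<in> N) \<or> (y \<notin> N \<and> z \<notin> N \<and> C n y z)"
proof -
  have m: "y \<in> M" "z \<in> M" "n \<in> M" "y \<noteq> a" "z \<noteq> a" using assms U by blast+
  consider "y \<in> N" "z \<in> N" | "y \<in> N" "z \<notin> N" | "y \<notin> N" "z \<in> N" | "y \<notin> N" "z \<notin> N" by blast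
  then show ?thesis
  proof cases
    case 1
    then show ?thesis using inside by blast
  next
    case 2
    then show ?thesis using outside assms C_excl[of z a y] m U by blast
  next
    case 3
    then show ?thesis using outside assms C_excl[of y a z] m U by blast
  next
    case 4
    then have "C y a n" "C z a n" using outside assms U by blast+
    then have "C y a z \<longleftrightarrow> C y n z" "C z a y \<longleftrightarrow> C z n y"
      using m U C_trans C_sym by meson+
    moreover have "y = z \<or> C a y z \<or> C y a z \<or> C z a y" "y = z \<or> C n y z \<or> C y n z \<or> C z n y"
      using C_cases m U 4 by metis+
    ultimately show ?thesis
      using C_excl[of a y z] C_excl[of n y z] C_excl[of y n z] C_excl[of z n y] C_excl[of y a z] C_excl[of z a y]
        C_pair[of a y] m U 4 by metis
  qed
qed

lemma branch_C_second:
  assumes "y \<in> U" "z \<in> U"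
  shows "C y a z \<longleftrightarrow> y \<notin> N \<and> (z \<in> N \<or> C y n z)"
proof -
  have m: "y \<in> M" "z \<in> M" "n \<in> M" "y \<noteq> a" "z \<noteq> a" using assms U by blast+
  consider "y \<in> N" "z \<in> N" | "y \<in> N" "z \<notin> N" | "y \<notin> N" "z \<in> N" | "y \<notin> N" "z \<notin> N" by blast
  then show ?thesis
  proof cases
    case 1
    then show ?thesis using inside C_asym[of a y z] m U by blast
  next
    case 2
    then show ?thesis using outside assms C_excl[of z a y] m U by blast
  next
    case 3
    then show ?thesis using outside assms by blast
  next
    case 4
    then have "C y a n" using outside assms U by blast
    then show ?thesis
      using m U C_trans C_sym 4 by meson
  qed
qed

lemma branch_lt:
  assumes "y \<in> U" "\<forall>u\<in>N. lt a u \<longleftrightarrow> s"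
  shows "lt a y \<longleftrightarrow> (if y \<in> N then s else lt n y)" and "lt y a \<longleftrightarrow> (if y \<in> N then \<not> s else lt y n)"
proof -
  have m: "y \<in> M" "n \<in> M" "y \<noteq> a" using assms U by blast+
  have "y \<notin> N \<Longrightarrow> (lt a y \<longleftrightarrow> lt n y) \<and> (lt y a \<longleftrightarrow> lt y n)"
    using C_side[of y a n] C_side'[of y a n] outside assms m U by blast
  then show "lt a y \<longleftrightarrow> (if y \<in> N then s else lt n y)" "lt y a \<longleftrightarrow> (if y \<in> N then \<not> s else lt y n)"
    using assms(2) lt_cases[of a y] lt_asym[of a y] m U by metis+
qed

end

end

section \<open>Partial isomorphisms and their one-point extensions\<close>

definition part_iso where
  "part_iso M C le M' C' le' p \<longleftrightarrow> finite p \<and> p \<subseteq> M \<times> M' \<and>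
    (\<forall>x x' y y'. (x, x') \<in> p \<longrightarrow> (y, y') \<in> p \<longrightarrow> (x = y \<longleftrightarrow> x' = y') \<and> (strict le x y \<longleftrightarrow> strict le' x' y')) \<and>
    (\<forall>x x' y y' z z'. (x, x') \<in> p \<longrightarrow> (y, y') \<in> p \<longrightarrow> (z, z') \<in> p \<longrightarrow> (C x y z \<longleftrightarrow> C' x' y' z'))"

lemma part_isoD:
  assumes "part_iso M C le M' C' le' p"
  shows "finite p" "p \<subseteq> M \<times> M'"
    and "\<And>x x' y y'. (x, x') \<in> p \<Longrightarrow> (y, y') \<in> p \<Longrightarrow> x = y \<longleftrightarrow> x' = y'"
    and "\<And>x x' y y'. (x, x') \<in> p \<Longrightarrow> (y, y') \<in> p \<Longrightarrow> strict le x y \<longleftrightarrow> strict le' x' y'"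
    and "\<And>x x' y y' z z'. (x, x') \<in> p \<Longrightarrow> (y, y') \<in> p \<Longrightarrow> (z, z') \<in> p \<Longrightarrow> C x y z \<longleftrightarrow> C' x' y' z'"
  using assms unfolding part_iso_def by (blast+)[5]

text \<open>The reason for taking relations instead of functions: the back step is the forth step
  for the converse.\<close>

lemma part_iso_converse:
  "part_iso M C le M' C' le' p \<Longrightarrow> part_iso M' C' le' M C le (p\<inverse>)"
  unfolding part_iso_def by auto

text \<open>A new leaf \<open>a\<close> hangs from the edge above a subtree \<open>N\<close> of the
  domain. The image of \<open>N\<close> is again a subtree, and a leaf \<open>b\<close> hung from
  the edge above it on the same side has the same relations to the range, as these are given by
  identical formulas.\<close>

lemma part_iso_extend:
  assumes "C_structure M C le" "C_structure M' C' le'" "part_iso M C le M' C' le' p" "a \<in> M"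
  shows "\<exists>b. part_iso M C le M' C' le' (insert (a, b) p)"
proof -
  interpret A: C_structure M C le by fact
  interpret B: C_structure M' C' le' by fact
  note p = part_isoD[OF assms(3)]
  consider (old) "a \<in> Domain p" | (empty) "p = {}" | (new) "p \<noteq> {}" "a \<notin> Domain p" by blast
  then show ?thesis
  proof cases
    case old
    then show ?thesis using assms(3) by (metis Domain.cases insert_absorb)
  next
    case empty
    obtain b where "b \<in> M'" using B.infinite_M by (metis ex_in_conv finite.emptyI)
    then have "part_iso M C le M' C' le' {(a, b)}"
      using assms(4) A.C_neq[of a a a] B.C_neq[of b b b] unfolding part_iso_def by auto
    then show ?thesis unfolding empty by blast
  next
    case new
    define U U' where "U = Domain p" and "U' = Range p"
    have U: "finite U" "U \<subseteq> M" "U \<noteq> {}" "a \<notin> U" and U': "finite U'" "U' \<subseteq> M'"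
      using new p(1,2) unfolding U_def U'_def by (auto simp: finite_Domain finite_Range)
    obtain N where N: "N \<subseteq> U" "N \<noteq> {}" "\<forall>u\<in>N. \<forall>v\<in>N. C a u v" "\<forall>w\<in>U - N. \<forall>u\<in>N. C w a u"
      using A.branch_position[OF U(1-3) assms(4) U(4)] .
    obtain n where n: "n \<in> N" using N by blast
    obtain n' where n': "(n, n') \<in> p" using n N(1) unfolding U_def by blast
    define N' where "N' = p `` N"
    have N'iff: "x' \<in> N' \<longleftrightarrow> x \<in> N" if "(x, x') \<in> p" for x x'
      using that p(3) unfolding N'_def by blast
    have N': "N' \<subseteq> U'" "n' \<in> N'" using n' n unfolding N'_def U'_def by blast+
    \<comment> \<open>From outside \<open>N\<close>, the point \<open>a\<close> lies in one branch
      with each of \<open>u\<close> and \<open>v\<close>, so these two share a branch as well;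
      \<open>p\<close> carries this over to the range.\<close>
    have sep: "C' w' u' v'" if wuv: "w' \<in> U' - N'" "u' \<in> N'" "v' \<in> N'" for w' u' v'
    proof -
      obtain u v where uv: "(u, u') \<in> p" "u \<in> N" "(v, v') \<in> p" "v \<in> N"
        using wuv unfolding N'_def by blast
      obtain w where w: "(w, w') \<in> p" "w \<in> U - N"
        using wuv unfolding U'_def U_def N'_def by blast
      have "C w u v"
        using A.C_trans[of w u a v] A.C_sym[of w a u] N(1) N(4)[rule_format, OF w(2)] U(2) uv w assms(4)
        by blast
      then show ?thesis using p(5) uv w by blast
    qed
    obtain b where b: "b \<in> M'" "\<forall>u\<in>N'. B.lt b u \<longleftrightarrow> A.lt a n" "\<forall>u\<in>N'. \<forall>v\<in>N'. C' b u v"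
      "\<forall>w\<in>U' - N'. \<forall>u\<in>N'. C' w b u"
      using B.branch_exists[OF U' N'(1) _ sep, of "A.lt a n"] N'(2) by blast
    have b_new: "b \<notin> U'"
    proof
      assume "b \<in> U'"
      show False
        using b B.C_neq[of b n' n'] B.C_neq[of b b n'] U' N' \<open>b \<in> U'\<close> by blast
    qed
    have side: "\<forall>u\<in>N. A.lt a u \<longleftrightarrow> A.lt a n"
    proof
      fix u assume u: "u \<in> N"
      show "A.lt a u \<longleftrightarrow> A.lt a n"
        using A.C_side[OF assms(4) _ _ N(3)[rule_format, OF u n]] u n N(1) U(2) by blast
    qed
    note A1 = A.branch_C_first[OF U(2) N(1) assms(4) U(4) n N(3,4)]
      and A2 = A.branch_C_second[OF U(2) N(1) assms(4) U(4) n N(3,4)]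
      and A3 = A.branch_lt[OF U(2) N(1) assms(4) U(4) n N(3,4) _ side]
      and B1 = B.branch_C_first[OF U'(2) N'(1) b(1) b_new N'(2) b(3,4)]
      and B2 = B.branch_C_second[OF U'(2) N'(1) b(1) b_new N'(2) b(3,4)]
      and B3 = B.branch_lt[OF U'(2) N'(1) b(1) b_new N'(2) b(3,4) _ b(2)]
    have mem: "x \<in> U \<and> x' \<in> U' \<and> x \<in> M \<and> x' \<in> M' \<and> x \<noteq> a \<and> x' \<noteq> b" if "(x, x') \<in> p" for x x'
      using that U U' b_new unfolding U_def U'_def by blast
    have 1: "C a y z \<longleftrightarrow> C' b y' z'" if "(y, y') \<in> p" "(z, z') \<in> p" for y y' z z'
      using A1[of y z] B1[of y' z'] mem that N'iff p(3) p(5)[OF n'] by metis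
    have 2: "C y a z \<longleftrightarrow> C' y' b z'" if "(y, y') \<in> p" "(z, z') \<in> p" for y y' z z'
      using A2[of y z] B2[of y' z'] mem that N'iff p(5)[OF _ n'] by metis
    have 3: "C y z a \<longleftrightarrow> C' y' z' b" if "(y, y') \<in> p" "(z, z') \<in> p" for y y' z z'
      using 2[OF that] A.C_sym B.C_sym mem that assms(4) b(1) by metis
    have 4: "A.lt a y \<longleftrightarrow> B.lt b y'" "A.lt y a \<longleftrightarrow> B.lt y' b" if "(y, y') \<in> p" for y y'
      using A3[of y] B3[of y'] mem that N'iff p(4)[OF _ n'] p(4)[OF n'] by metis+
    have 5: "\<not> C a a y" "\<not> C a y a" "C y a a" "\<not> C' b b y'" "\<not> C' b y' b" "C' y' b b"
      if "(y, y') \<in> p" for y y'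
      using A.C_neq A.C_pair B.C_neq B.C_pair mem that assms(4) b(1) by metis+
    have 6: "\<not> C a a a" "\<not> C' b b b" using A.C_neq B.C_neq assms(4) b(1) by blast+
    have "part_iso M C le M' C' le' (insert (a, b) p)"
      unfolding part_iso_def
    proof (intro conjI allI impI)
      show "finite (insert (a, b) p)" using p by simp
      show "insert (a, b) p \<subseteq> M \<times> M'" using p assms b by simp
      fix x x' y y'
      assume xy: "(x, x') \<in> insert (a, b) p" "(y, y') \<in> insert (a, b) p"
      show "(x = y) = (x' = y')"
        using xy p(3)[of x x' y y'] mem by auto
      show "A.lt x y = B.lt x' y'"
        using xy p(4)[of x x' y y'] 4 by auto
      fix z z' assume z: "(z, z') \<in> insert (a, b) p"
      show "C x y z = C' x' y' z'"
        using xy z p(5)[of x x' y y' z z'] 1 2 3 5 6 by auto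
    qed
    then show ?thesis by blast
  qed
qed

text \<open>For \<open>p = {}\<close> this is the uniqueness of the structure, for two equal
  structures its homogeneity.\<close>

lemma part_iso_extends_to_iso:
  assumes "C_structure M C le" "C_structure M' C' le'" "part_iso M C le M' C' le' p"
  obtains f where "bij_betw f M M'" "\<forall>x x'. (x, x') \<in> p \<longrightarrow> f x = x'"
    "\<forall>x\<in>M. \<forall>y\<in>M. strict le x y \<longleftrightarrow> strict le' (f x) (f y)"
    "\<forall>x\<in>M. \<forall>y\<in>M. \<forall>z\<in>M. C x y z \<longleftrightarrow> C' (f x) (f y) (f z)"
proof -
  define P where "P = Collect (part_iso M C le M' C' le')"
  obtain f where f: "bij_betw f M M'"
    "\<And>S. finite S \<Longrightarrow> S \<subseteq> M \<Longrightarrow> \<exists>q\<in>P. p \<subseteq> q \<and> (\<forall>x\<in>S. (x, f x) \<in> q)"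
  proof (rule back_and_forth[of M M' p P])
    show "countable M" "countable M'"
      using assms C_structure.countable_M by blast+
    show "\<exists>b. insert (a, b) q \<in> P" if "q \<in> P" "a \<in> M" for q a
      using part_iso_extend[OF assms(1,2)] that unfolding P_def by blast
    show "\<exists>a. insert (a, b) q \<in> P" if q: "q \<in> P" "b \<in> M'" for q b
    proof -
      obtain a where "part_iso M' C' le' M C le (insert (b, a) (q\<inverse>))"
        using part_iso_extend[OF assms(2,1) part_iso_converse] q unfolding P_def by blast
      moreover have "(insert (b, a) (q\<inverse>))\<inverse> = insert (a, b) q" by auto
      ultimately show ?thesis using part_iso_converse unfolding P_def by fastforce
    qed
  qed (use assms(3) in \<open>auto simp: P_def dest: part_isoD\<close>)
  have 1: "f x = x'" if "(x, x') \<in> p" for x x'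
  proof -
    have xM: "x \<in> M" using part_isoD(2)[OF assms(3)] that by blast
    then obtain q where q: "part_iso M C le M' C' le' q" "p \<subseteq> q" "(x, f x) \<in> q"
      using f(2)[of "{x}"] unfolding P_def by auto
    then show ?thesis using part_isoD(3)[OF q(1), of x "f x" x x'] that by blast
  qed
  have 2: "strict le x y \<longleftrightarrow> strict le' (f x) (f y)" if xM: "x \<in> M" "y \<in> M" for x y
  proof -
    obtain q where "part_iso M C le M' C' le' q" "(x, f x) \<in> q" "(y, f y) \<in> q"
      using f(2)[of "{x, y}"] xM unfolding P_def by auto
    then show ?thesis by (rule part_isoD(4))
  qed
  have 3: "C x y z \<longleftrightarrow> C' (f x) (f y) (f z)" if xM: "x \<in> M" "y \<in> M" "z \<in> M" for x y z
  proof -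
    obtain q where "part_iso M C le M' C' le' q" "(x, f x) \<in> q" "(y, f y) \<in> q" "(z, f z) \<in> q"
      using f(2)[of "{x, y, z}"] xM unfolding P_def by auto
    then show ?thesis by (rule part_isoD(5))
  qed
  show thesis using that[OF f(1)] 1 2 3 by blast
qed

section \<open>Splits of finite vertex sets\<close>

text \<open>What a root split leaves visible in the edges; as neither the order nor \<open>C\<close>
  is mentioned, every \<open>edge_iso\<close> carries it along. On two points both arrangements
  qualify, the simplest failure of uniqueness.\<close>

definition edge_split :: "'a set set \<Rightarrow> 'a set \<Rightarrow> 'a set \<Rightarrow> 'a set \<Rightarrow> bool" where
  "edge_split E U L R \<longleftrightarrow> U = L \<union> R \<and> L \<inter> R = {} \<and> L \<noteq> {} \<and> R \<noteq> {} \<and>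
    (\<forall>l\<in>L. \<forall>r\<in>R. \<forall>r'\<in>R. r \<noteq> r' \<longrightarrow> {l, r, r'} \<in> E) \<and>
    (\<forall>r\<in>R. \<forall>l\<in>L. \<forall>l'\<in>L. l \<noteq> l' \<longrightarrow> {r, l, l'} \<notin> E)"

definition edge_iso :: "'a set set \<Rightarrow> 'b set set \<Rightarrow> 'a set \<Rightarrow> 'b set \<Rightarrow> ('a \<Rightarrow> 'b) \<Rightarrow> bool" where
  "edge_iso E F U U' h \<longleftrightarrow> bij_betw h U U' \<and>
    (\<forall>x\<in>U. \<forall>y\<in>U. \<forall>z\<in>U. x \<noteq> y \<longrightarrow> x \<noteq> z \<longrightarrow> y \<noteq> z \<longrightarrow> ({x, y, z} \<in> E \<longleftrightarrow> {h x, h y, h z} \<in> F))"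

lemma edge_splitD:
  assumes "edge_split E U L R"
  shows "U = L \<union> R" "L \<inter> R = {}" "L \<noteq> {}" "R \<noteq> {}"
    and "\<And>l r r'. \<lbrakk>l \<in> L; r \<in> R; r' \<in> R; r \<noteq> r'\<rbrakk> \<Longrightarrow> {l, r, r'} \<in> E"
    and "\<And>l r l'. \<lbrakk>r \<in> R; l \<in> L; l' \<in> L; l \<noteq> l'\<rbrakk> \<Longrightarrow> {r, l, l'} \<notin> E"
  using assms unfolding edge_split_def by blast+

lemma edge_split_image:
  assumes "edge_split E U L R" "edge_iso E F U U' h"
  shows "edge_split F U' (h ` L) (h ` R)"
proof -
  note s = edge_splitD[OF assms(1)]
  have h: "inj_on h U" "h ` U = U'"
    using assms(2) unfolding edge_iso_def bij_betw_def by blast+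
  have e: "{x, y, z} \<in> E \<longleftrightarrow> {h x, h y, h z} \<in> F" if "x \<in> U" "y \<in> U" "z \<in> U" "x \<noteq> y" "x \<noteq> z" "y \<noteq> z" for x y z
    using assms(2) that unfolding edge_iso_def by blast
  have "{h l, h r, h r'} \<in> F" if "l \<in> L" "r \<in> R" "r' \<in> R" "h r \<noteq> h r'" for l r r'
    using e[of l r r'] s(5)[of l r r'] that s(1,2) by blast
  moreover have "{h r, h l, h l'} \<notin> F" if "r \<in> R" "l \<in> L" "l' \<in> L" "h l \<noteq> h l'" for l r l'
    using e[of r l l'] s(6)[of r l l'] that s(1,2) by blast
  moreover have "h ` L \<inter> h ` R = {}"
    using h(1) s(1,2) inj_on_image_Int[of h U L R] by auto
  ultimately show ?thesis
    unfolding edge_split_def using s(1-4) h(2) by (auto simp: image_Un)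
qed

text \<open>If \<open>c\<close> changes sides while \<open>l\<close> and \<open>r\<close> stay, the
  triple \<open>{l, c, r}\<close> is an edge by one split and a nonedge by the other. So if points
  move in one direction only, none moves. If \<open>a\<close> and \<open>b\<close> move in opposite
  directions, a second point moving along with either would again give one triple both
  statuses.\<close>

lemma edge_split_unique:
  assumes "edge_split E U L R" "edge_split E U L' R'"
  shows "(L' = L \<and> R' = R) \<or>
    (\<exists>a b. a \<in> L \<and> b \<in> R \<and> L' = insert b (L - {a}) \<and> R' = insert a (R - {b}))"
proof -
  note s = edge_splitD[OF assms(1)] and s' = edge_splitD[OF assms(2)]
  have no1: False if "c \<in> L' \<inter> R" "l \<in> L \<inter> L'" "r \<in> R \<inter> R'" for c l r
    using s(5)[of l c r] s'(6)[of r l c] that s(2) s'(2) by (auto simp: insert_commute)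
  have no2: False if "c \<in> L \<inter> R'" "l \<in> L \<inter> L'" "r \<in> R \<inter> R'" for c l r
    using s(6)[of r l c] s'(5)[of l c r] that s(2) s'(2) by (auto simp: insert_commute)
  show ?thesis
  proof (cases "L \<inter> R' = {} \<or> R \<inter> L' = {}")
    case True
    then have "L' = L"
    proof
      assume *: "L \<inter> R' = {}"
      then have sub: "L \<subseteq> L'" "R' \<subseteq> R" using s(1) s'(1) by blast+
      obtain l r where "l \<in> L" "r \<in> R'" using s(3) s'(4) by blast
      then have "L' \<inter> R = {}" using no1[of _ l r] sub by blast
      then show "L' = L" using sub s(1) s'(1) by blast
    next
      assume *: "R \<inter> L' = {}"
      then have sub: "L' \<subseteq> L" "R \<subseteq> R'" using s(1) s'(1) by blast+
      obtain l r where "l \<in> L'" "r \<in> R" using s(4) s'(3) by blast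
      then have "L \<inter> R' = {}" using no2[of _ l r] sub by blast
      then show "L' = L" using sub s(1) s'(1) by blast
    qed
    then show ?thesis using s(1,2) s'(1,2) by blast
  next
    case False
    then obtain a b where ab: "a \<in> L \<inter> R'" "b \<in> R \<inter> L'" by blast
    have "c = a" if "c \<in> L \<inter> R'" for c
      using s(6)[of b a c] s'(5)[of b a c] that ab by auto
    moreover have "c = b" if "c \<in> R \<inter> L'" for c
      using s(5)[of a b c] s'(6)[of a b c] that ab by auto
    ultimately have "L' = insert b (L - {a}) \<and> R' = insert a (R - {b})"
      using s(1,2) s'(1,2) ab by blast
    then show ?thesis using ab by blast
  qed
qed

text \<open>The exchanged points are twins: with two points of \<open>L - {a}\<close> each of them
  forms a nonedge, read off one split or the other, and with two points of \<open>R - {b}\<close>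
  each forms an edge. So the transposition of \<open>a\<close> and \<open>b\<close> preserves the
  edges inside both parts.\<close>

lemma edge_splits_iso:
  assumes "edge_split E U L R" "edge_split E U L' R'"
  obtains g where "edge_iso E E L L' g" "edge_iso E E R R' g"
proof -
  note s = edge_splitD[OF assms(1)] and s' = edge_splitD[OF assms(2)]
  consider "L' = L" "R' = R"
    | a b where "a \<in> L" "b \<in> R" "L' = insert b (L - {a})" "R' = insert a (R - {b})"
    using edge_split_unique[OF assms] by blast
  then show thesis
  proof cases
    case 1
    then show thesis using that[of id] unfolding edge_iso_def by auto
  next
    case 2
    have ab: "a \<notin> R" "b \<notin> L" using 2 s(2) by blast+
    define g where "g x = (if x = a then b else if x = b then a else x)" for x
    have g: "g a = b" "g b = a" "\<And>x. x \<noteq> a \<Longrightarrow> x \<noteq> b \<Longrightarrow> g x = x" unfolding g_def by auto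
    have "bij_betw g L L'" "bij_betw g R R'"
      using 2 ab g by (auto simp: bij_betw_def inj_on_def g_def)
    moreover have "{a, y, z} \<notin> E" "{b, y, z} \<notin> E" if "y \<in> L" "z \<in> L" "y \<noteq> a" "z \<noteq> a" "y \<noteq> z" for y z
      using that s(6)[of b y z] s'(6)[of a y z] 2 by auto
    moreover have "{a, y, z} \<in> E" "{b, y, z} \<in> E" if "y \<in> R" "z \<in> R" "y \<noteq> b" "z \<noteq> b" "y \<noteq> z" for y z
      using that s(5)[of a y z] s'(5)[of b y z] 2 by auto
    ultimately have "edge_iso E E L L' g" "edge_iso E E R R' g"
      using ab unfolding edge_iso_def g_def by (auto simp: insert_commute)
    then show thesis using that by blast
  qed
qed

lemma edge_iso_comp:
  assumes "edge_iso E F U U' h" "edge_iso F G U' U'' g"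
  shows "edge_iso E G U U'' (g \<circ> h)"
proof -
  have "h x \<noteq> h y" "h x \<in> U'" if "x \<in> U" "y \<in> U" "x \<noteq> y" for x y
    using assms(1) that unfolding edge_iso_def bij_betw_def inj_on_def by blast+
  then show ?thesis
    using assms unfolding edge_iso_def by (auto intro: bij_betw_trans)
qed

lemma edge_iso_restrict:
  assumes "edge_iso E F U U' h" "L \<subseteq> U"
  shows "edge_iso E F L (h ` L) h"
  using assms unfolding edge_iso_def bij_betw_def inj_on_def by blast

section \<open>Root splits of finite point sets\<close>

context C_structure
begin

definition tree_split :: "'a set \<Rightarrow> 'a set \<Rightarrow> 'a set \<Rightarrow> bool" where
  "tree_split U L R \<longleftrightarrow> U = L \<union> R \<and> L \<noteq> {} \<and> R \<noteq> {} \<and> (\<forall>l\<in>L. \<forall>r\<in>R. lt l r) \<and>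
    (\<forall>l\<in>L. \<forall>r\<in>R. \<forall>r'\<in>R. C l r r') \<and> (\<forall>r\<in>R. \<forall>l\<in>L. \<forall>l'\<in>L. C r l l')"

lemma tree_split_imp_edge_split:
  assumes "U \<subseteq> M" "tree_split U L R"
  shows "edge_split E U L R"
proof -
  have s: "U = L \<union> R" "L \<noteq> {}" "R \<noteq> {}" "\<And>l r. l \<in> L \<Longrightarrow> r \<in> R \<Longrightarrow> lt l r"
    "\<And>l r r'. \<lbrakk>l \<in> L; r \<in> R; r' \<in> R\<rbrakk> \<Longrightarrow> C l r r'" "\<And>r l l'. \<lbrakk>r \<in> R; l \<in> L; l' \<in> L\<rbrakk> \<Longrightarrow> C r l l'"
    using assms(2) unfolding tree_split_def by blast+
  have m: "x \<in> M" if "x \<in> L \<or> x \<in> R" for x using that s(1) assms(1) by blast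
  have edge: "{l, r, r'} \<in> E" if "l \<in> L" "r \<in> R" "r' \<in> R" "r \<noteq> r'" for l r r'
    using edge_iff[of l r r'] s(4)[of l r] s(4)[of l r'] s(5)[of l r r'] m that by blast
  have aux: "{l, l', r} \<notin> E" if "r \<in> R" "l \<in> L" "l' \<in> L" "lt l l'" for r l l'
    using edge_iff[of l l' r] s(4)[of l r] s(4)[of l' r] s(6)[of r l l'] C_excl[of r l l'] m that lt_neq by blast
  have nonedge: "{r, l, l'} \<notin> E" if "r \<in> R" "l \<in> L" "l' \<in> L" "l \<noteq> l'" for r l l'
    using aux[of r l l'] aux[of r l' l] lt_cases[of l l'] m that by (auto simp: insert_commute)
  have "L \<inter> R = {}" using s(4) lt_neq by blast
  then show ?thesis
    unfolding edge_split_def using s(1-3) edge nonedge by simp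
qed

text \<open>The points \<open>y\<close> and \<open>z\<close> are chosen on different sides of the
  root. \<open>Y\<close> is the branch of \<open>y\<close> seen from \<open>z\<close>,
  \<open>Z\<close> the branch of \<open>z\<close> seen from \<open>y\<close>, and whichever lies to
  the left becomes \<open>L\<close>.\<close>

lemma tree_split_exists:
  assumes "finite U" "U \<subseteq> M" "x \<in> U" "y \<in> U" "x \<noteq> y"
  obtains L R where "tree_split U L R"
proof -
  obtain z where z: "z \<in> U" "\<forall>u\<in>U. \<not> C u y z"
    using C_far_point[OF assms(1,2,4)] .
  have "z \<noteq> y" using z C_pair[of x y] assms by blast
  define Y Z where "Y = {u \<in> U. C z u y}" and "Z = {u \<in> U. C y u z}"
  have m: "u \<in> M" if "u \<in> U" for u using that assms by blast
  have yz: "y \<in> Y" "z \<in> Z"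
    using C_pair m z(1) assms(4) \<open>z \<noteq> y\<close> unfolding Y_def Z_def by auto
  have U: "U = Y \<union> Z"
  proof -
    \<comment> \<open>By 2-regularity the only third possibility is \<open>C u y z\<close>, excluded
      by the choice of \<open>z\<close>.\<close>
    have "u \<in> Y \<union> Z" if "u \<in> U" for u
      using C_cases[of u y z] C_sym m z yz assms(4) that \<open>z \<noteq> y\<close> unfolding Y_def Z_def by blast
    then show ?thesis unfolding Y_def Z_def by blast
  qed
  have Ya: "C a b z" "lt a b \<longleftrightarrow> lt y z" "lt b a \<longleftrightarrow> lt z y" if "a \<in> Y" "b \<in> Z" for a b
  proof -
    have ab: "a \<in> M" "b \<in> M" "y \<in> M" "z \<in> M" "C z a y" "C y b z"
      using that m z(1) assms(4) unfolding Y_def Z_def by auto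
    have "\<not> C y a z" using C_excl[of z a y] ab by blast
    then show "C a b z" using C_third[of y b z a] ab by blast
    then show "lt a b \<longleftrightarrow> lt y z" "lt b a \<longleftrightarrow> lt z y"
      using C_side[of a b z] C_side'[of z a y] C_side'[of a b z] C_side[of z a y] ab by blast+
  qed
  have Za: "C b a y" if "a \<in> Y" "b \<in> Z" for a b
  proof -
    have ab: "a \<in> M" "b \<in> M" "y \<in> M" "z \<in> M" "C z a y" "C y b z"
      using that m z(1) assms(4) unfolding Y_def Z_def by auto
    have "\<not> C z b y" using C_excl[of y b z] ab by blast
    then show "C b a y" using C_third[of z a y b] ab by blast
  qed
  have CY: "C a b b'" if "a \<in> Y" "b \<in> Z" "b' \<in> Z" for a b b'
    using Ya(1)[OF that(1,2)] Ya(1)[OF that(1,3)] C_trans[of a b z b'] C_sym[of a b' z] m z(1) that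
    unfolding Y_def Z_def by blast
  have CZ: "C b a a'" if "a \<in> Y" "a' \<in> Y" "b \<in> Z" for a a' b
    using Za[OF that(1,3)] Za[OF that(2,3)] C_trans[of b a y a'] C_sym[of b a' y] m assms(4) that
    unfolding Y_def Z_def by blast
  show thesis
  proof (cases "lt y z")
    case True
    then show thesis using that[of Y Z] U yz CY CZ Ya unfolding tree_split_def by blast
  next
    case False
    then have "lt z y" using lt_cases m z(1) assms(4) \<open>z \<noteq> y\<close> by blast
    then show thesis using that[of Z Y] U yz CY CZ Ya unfolding tree_split_def by blast
  qed
qed

text \<open>Relations with arguments from both halves are dictated by the splits, so partial
  isomorphisms of the halves can be combined freely.\<close>

lemma tree_splits_glue:
  assumes "U \<subseteq> M" "U' \<subseteq> M" "tree_split U L R" "tree_split U' L' R'"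
    and f: "part_iso M C le M C le p" "Domain p = L" "Range p = L'"
    and g: "part_iso M C le M C le q" "Domain q = R" "Range q = R'"
  shows "part_iso M C le M C le (p \<union> q)"
proof -
  have s: "U = L \<union> R" "\<And>l r. l \<in> L \<Longrightarrow> r \<in> R \<Longrightarrow> lt l r \<and> \<not> lt r l \<and> l \<noteq> r"
    "\<And>l r r'. \<lbrakk>l \<in> L; r \<in> R; r' \<in> R\<rbrakk> \<Longrightarrow> C l r r' \<and> \<not> C r l r' \<and> \<not> C r r' l"
    "\<And>r l l'. \<lbrakk>r \<in> R; l \<in> L; l' \<in> L\<rbrakk> \<Longrightarrow> C r l l' \<and> \<not> C l r l' \<and> \<not> C l l' r"
    using assms(1,3) lt_asym lt_neq C_excl unfolding tree_split_def by (blast, metis subsetD UnCI, metis subsetD UnCI, metis subsetD UnCI)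
  have s': "U' = L' \<union> R'" "\<And>l r. l \<in> L' \<Longrightarrow> r \<in> R' \<Longrightarrow> lt l r \<and> \<not> lt r l \<and> l \<noteq> r"
    "\<And>l r r'. \<lbrakk>l \<in> L'; r \<in> R'; r' \<in> R'\<rbrakk> \<Longrightarrow> C l r r' \<and> \<not> C r l r' \<and> \<not> C r r' l"
    "\<And>r l l'. \<lbrakk>r \<in> R'; l \<in> L'; l' \<in> L'\<rbrakk> \<Longrightarrow> C r l l' \<and> \<not> C l r l' \<and> \<not> C l l' r"
    using assms(2,4) lt_asym lt_neq C_excl unfolding tree_split_def by (blast, metis subsetD UnCI, metis subsetD UnCI, metis subsetD UnCI)
  note p = part_isoD[OF f(1)] and q = part_isoD[OF g(1)]
  have pm: "x \<in> L \<and> x' \<in> L'" if "(x, x') \<in> p" for x x' using that f by blast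
  have qm: "x \<in> R \<and> x' \<in> R'" if "(x, x') \<in> q" for x x' using that g by blast
  show ?thesis
    unfolding part_iso_def
  proof (intro conjI allI impI)
    show "finite (p \<union> q)" using p(1) q(1) by blast
    show "p \<union> q \<subseteq> M \<times> M" using p(2) q(2) by blast
    fix x x' y y'
    assume xy: "(x, x') \<in> p \<union> q" "(y, y') \<in> p \<union> q"
    then consider "(x, x') \<in> p" "(y, y') \<in> p" | "(x, x') \<in> q" "(y, y') \<in> q"
      | "(x, x') \<in> p" "(y, y') \<in> q" | "(x, x') \<in> q" "(y, y') \<in> p" by blast
    note xy_cases = this
    show "(x = y) = (x' = y')"
      using xy_cases p(3)[of x x' y y'] q(3)[of x x' y y'] pm qm s(2) s'(2) by cases metis+
    show "lt x y = lt x' y'"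
      using xy_cases p(4)[of x x' y y'] q(4)[of x x' y y'] pm qm s(2) s'(2) by cases metis+
    fix z z' assume "(z, z') \<in> p \<union> q"
    then have "(z, z') \<in> p \<or> (z, z') \<in> q" by blast
    then show "C x y z = C x' y' z'"
      using p(5)[of x x' y y' z z'] q(5)[of x x' y y' z z'] pm qm s(3,4) s'(3,4)
      by (cases rule: xy_cases) metis+
  qed
qed

text \<open>Only the domain and the range of \<open>p\<close> are prescribed by \<open>h\<close>.
  The map \<open>h\<close> itself may violate the order, for instance by swapping two points; this
  is the gap between set-homogeneity and homogeneity.\<close>

lemma edge_iso_imp_part_iso:
  assumes "finite U" "U \<subseteq> M" "U' \<subseteq> M" "edge_iso E E U U' h"
  shows "\<exists>p. part_iso M C le M C le p \<and> Domain p = U \<and> Range p = U'"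
  using assms
proof (induction "card U" arbitrary: U U' h rule: less_induct)
  case less
  have bij: "bij_betw h U U'" using less.prems(4) unfolding edge_iso_def by blast
  consider "U = {}" | x where "U = {x}" | x y where "x \<in> U" "y \<in> U" "x \<noteq> y" by blast
  then show ?case
  proof cases
    case 1
    then have "U' = {}" using bij bij_betw_imp_surj_on by fastforce
    then show ?thesis using 1 by (intro exI[of _ "{}"]) (auto simp: part_iso_def)
  next
    case 2
    then have "U' = {h x}" using bij bij_betw_imp_surj_on by fastforce
    then show ?thesis
      using 2 less.prems C_neq[of x x x] C_neq[of "h x" "h x" "h x"]
      by (intro exI[of _ "{(x, h x)}"]) (auto simp: part_iso_def)
  next
    case 3
    have xy': "h x \<in> U'" "h y \<in> U'" "h x \<noteq> h y" "finite U'"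
      using 3 bij less.prems(1) bij_betw_finite by (auto simp: bij_betw_def inj_on_def)
    obtain L R where LR: "tree_split U L R"
      using tree_split_exists[OF less.prems(1,2) 3] .
    obtain L' R' where LR': "tree_split U' L' R'"
      using tree_split_exists[OF xy'(4) less.prems(3) xy'(1-3)] .
    note s = tree_split_imp_edge_split[OF less.prems(2) LR]
      and s' = tree_split_imp_edge_split[OF less.prems(3) LR']
    \<comment> \<open>\<open>h\<close> sends the root split of \<open>U\<close> to some split of
      \<open>U'\<close>, perhaps not the one at its root; \<open>g\<close> corrects this before the
      recursion enters the halves.\<close>
    obtain g where g: "edge_iso E E (h ` L) L' g" "edge_iso E E (h ` R) R' g"
      using edge_splits_iso[OF edge_split_image[OF s less.prems(4)] s'] .
    have sub: "L \<subseteq> U" "R \<subseteq> U" "L' \<subseteq> M" "R' \<subseteq> M"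
      using edge_splitD(1)[OF s] edge_splitD(1)[OF s'] less.prems by blast+
    have "L \<subset> U" "R \<subset> U" using edge_splitD(1-4)[OF s] by blast+
    then have card: "card L < card U" "card R < card U" using less.prems(1) psubset_card_mono by blast+
    obtain p where p: "part_iso M C le M C le p" "Domain p = L" "Range p = L'"
      using less.hyps[OF card(1) finite_subset[OF sub(1) less.prems(1)] subset_trans[OF sub(1) less.prems(2)] sub(3)
        edge_iso_comp[OF edge_iso_restrict[OF less.prems(4) sub(1)] g(1)]] by (elim exE conjE)
    obtain q where q: "part_iso M C le M C le q" "Domain q = R" "Range q = R'"
      using less.hyps[OF card(2) finite_subset[OF sub(2) less.prems(1)] subset_trans[OF sub(2) less.prems(2)] sub(4)
        edge_iso_comp[OF edge_iso_restrict[OF less.prems(4) sub(2)] g(2)]] by (elim exE conjE)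
    show ?thesis
      using tree_splits_glue[OF less.prems(2,3) LR LR' p q] p(2,3) q(2,3)
        edge_splitD(1)[OF s] edge_splitD(1)[OF s'] by blast
  qed
qed

text \<open>With two points on each side, the exchange allowed by \<open>edge_split_unique\<close>
  is impossible, so the edges single out the root split and with it the order of \<open>x\<close>
  and \<open>y\<close>.\<close>

lemma lt_iff_edge_split:
  assumes "x \<in> M" "y \<in> M" "x \<noteq> y"
  shows "lt x y \<longleftrightarrow> (\<exists>c\<in>M. \<exists>d\<in>M. distinct [x, y, c, d] \<and> edge_split E {x, c, y, d} {x, c} {y, d})"
proof
  assume xy: "lt x y"
  \<comment> \<open>The point \<open>c\<close> is grown next to \<open>x\<close>, closer to it than
    \<open>y\<close>; then \<open>d\<close> is grown next to \<open>y\<close>, closer to it than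
    \<open>c\<close> and therefore also than \<open>x\<close>.\<close>
  obtain c where c: "c \<in> M" "C y x c" "lt x c"
    using C_dense_right[of y x x] C_pair assms by metis
  have "c \<noteq> y" using C_neq c assms by metis
  obtain d where d: "d \<in> M" "C c y d" "lt y d"
    using C_dense_right[of c y y] C_pair assms c \<open>c \<noteq> y\<close> by metis
  have "\<not> C c x d"
    using C_trans[of c x d y] C_excl[of y x c] C_sym[of c y d] assms c d by blast
  then have xyd: "C x y d" using C_third[of c y d x] assms c d by blast
  have "\<not> C x c d"
    using C_trans[of x c d y] C_excl[of y x c] C_sym[of x y d] assms c d xyd by blast
  then have "C d x c"
    using C_third[of y x c d] C_excl[of c y d] C_sym assms c d xyd C_cases[of x c d] C_neq lt_neq by metis
  have "lt c y" using C_side'[of y x c] assms c xy by blast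
  have "lt x d" "lt c d" using lt_trans assms c d xy \<open>lt c y\<close> by blast+
  have "tree_split {x, c, y, d} {x, c} {y, d}"
    unfolding tree_split_def
    using xy \<open>lt c y\<close> \<open>lt x d\<close> \<open>lt c d\<close> xyd d(2) c(2) \<open>C d x c\<close>
      C_sym[OF assms(1,2) d(1) xyd] C_sym[OF c(1) assms(2) d(1,2)] C_sym[OF assms(2,1) c(1,2)] C_sym[OF d(1) assms(1) c(1) \<open>C d x c\<close>]
      C_pair[OF assms(1,2)] C_pair[OF assms(2,1)] C_pair[OF assms(1) d(1)] C_pair[OF d(1) assms(1)]
      C_pair[OF c(1) assms(2)] C_pair[OF assms(2) c(1)] C_pair[OF c(1) d(1)] C_pair[OF d(1) c(1)]
      lt_neq[OF xy] lt_neq[OF \<open>lt c y\<close>] lt_neq[OF \<open>lt x d\<close>] lt_neq[OF \<open>lt c d\<close>]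
    by auto
  then have "edge_split E {x, c, y, d} {x, c} {y, d}"
    using tree_split_imp_edge_split assms c(1) d(1) by (metis insert_subset empty_subsetI)
  moreover have "distinct [x, y, c, d]"
    using assms(3) c(3) d(3) \<open>lt x d\<close> \<open>lt c y\<close> \<open>lt c d\<close> lt_neq by auto
  ultimately show "\<exists>c\<in>M. \<exists>d\<in>M. distinct [x, y, c, d] \<and> edge_split E {x, c, y, d} {x, c} {y, d}"
    using c d by blast
next
  assume "\<exists>c\<in>M. \<exists>d\<in>M. distinct [x, y, c, d] \<and> edge_split E {x, c, y, d} {x, c} {y, d}"
  then obtain c d where cd: "c \<in> M" "d \<in> M" "distinct [x, y, c, d]" "edge_split E {x, c, y, d} {x, c} {y, d}"
    by blast
  let ?U = "{x, c, y, d}"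
  obtain L R where LR: "tree_split ?U L R"
    using tree_split_exists[of ?U x y] assms cd by auto
  have LR': "edge_split E ?U L R"
    using tree_split_imp_edge_split LR assms cd by simp
  \<comment> \<open>The points \<open>l\<close> and \<open>r\<close> that stay put make
    \<open>{l, a, r}\<close> an edge by the root split and a nonedge by the given one.\<close>
  have False if ab: "a \<in> {x, c}" "b \<in> {y, d}" "L = insert b ({x, c} - {a})" "R = insert a ({y, d} - {b})" for a b
  proof -
    obtain l where l: "l \<in> {x, c}" "l \<noteq> a" using cd(3) ab(1) by auto
    obtain r where r: "r \<in> {y, d}" "r \<noteq> b" using cd(3) ab(2) by auto
    have "a \<noteq> r" using cd(3) ab(1) r(1) by auto
    then have "{l, a, r} \<in> E" "{r, l, a} \<notin> E"
      using edge_splitD(5)[OF LR', of l a r] edge_splitD(6)[OF cd(4), of r l a] ab l r by auto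
    then show False by (simp add: insert_commute)
  qed
  then have "L = {x, c} \<and> R = {y, d}"
    using edge_split_unique[OF cd(4) LR'] by blast
  then show "lt x y" using LR unfolding tree_split_def by blast
qed

end

section \<open>Homogeneity properties of M3\<close>

lemma iso_preserves_M3_edges:
  assumes "bij_betw f M M'"
    "\<forall>x\<in>M. \<forall>y\<in>M. strict le x y \<longleftrightarrow> strict le' (f x) (f y)"
    "\<forall>x\<in>M. \<forall>y\<in>M. \<forall>z\<in>M. C x y z \<longleftrightarrow> C' (f x) (f y) (f z)"
    "A \<subseteq> M"
  shows "A \<in> M3_edges M C le \<longleftrightarrow> f ` A \<in> M3_edges M' C' le'"
proof
  have inj: "inj_on f M" and im: "f ` M = M'" using assms(1) by (auto simp: bij_betw_def)
  show "f ` A \<in> M3_edges M' C' le'" if A: "A \<in> M3_edges M C le"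
  proof -
    obtain x y z where x: "A = {x, y, z}" "x \<in> M" "y \<in> M" "z \<in> M" "y \<noteq> z"
      "strict le x y" "strict le x z" "C x y z"
      using A unfolding M3_edges_def by blast
    then have "strict le' (f x) (f y)" "strict le' (f x) (f z)" "C' (f x) (f y) (f z)" "f y \<noteq> f z"
      "f x \<in> M'" "f y \<in> M'" "f z \<in> M'"
      using assms(2,3) inj im by (auto simp: inj_on_def)
    moreover have "f ` A = {f x, f y, f z}" using x by simp
    ultimately show ?thesis unfolding M3_edges_def strict_def by blast
  qed
  show "A \<in> M3_edges M C le" if A: "f ` A \<in> M3_edges M' C' le'"
  proof -
    obtain x' y' z' where x': "f ` A = {x', y', z'}" "y' \<noteq> z'"
      "strict le' x' y'" "strict le' x' z'" "C' x' y' z'"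
      using A unfolding M3_edges_def by blast
    then have "x' \<in> f ` A" "y' \<in> f ` A" "z' \<in> f ` A" by simp_all
    then obtain x y z where x: "x \<in> A" "y \<in> A" "z \<in> A" "f x = x'" "f y = y'" "f z = z'" by blast
    have "f ` A = f ` {x, y, z}" using x x' by simp
    then have "A = {x, y, z}"
      using inj_on_image_eq_iff[OF inj assms(4), of "{x, y, z}"] x assms(4) by blast
    moreover have "x \<in> M" "y \<in> M" "z \<in> M" using x assms(4) by blast+
    moreover have "strict le x y" "strict le x z" "C x y z" "y \<noteq> z"
      using x x' assms(2,3) \<open>x \<in> M\<close> \<open>y \<in> M\<close> \<open>z \<in> M\<close> by blast+
    ultimately show ?thesis unfolding M3_edges_def strict_def by blast
  qed
qed

lemma M3_structures_hg_isomorphic: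
  assumes "C_structure M C le" "C_structure M' C' le'"
  shows "hg_isomorphic M (M3_edges M C le) M' (M3_edges M' C' le')"
proof -
  have empty: "part_iso M C le M' C' le' {}" by (simp add: part_iso_def)
  obtain f where "bij_betw f M M'" "\<forall>x x'. (x, x') \<in> {} \<longrightarrow> f x = x'"
    "\<forall>x\<in>M. \<forall>y\<in>M. strict le x y \<longleftrightarrow> strict le' (f x) (f y)"
    "\<forall>x\<in>M. \<forall>y\<in>M. \<forall>z\<in>M. C x y z \<longleftrightarrow> C' (f x) (f y) (f z)"
    using part_iso_extends_to_iso[OF assms empty] .
  then show ?thesis
    unfolding hg_isomorphic_def by (intro exI conjI allI impI iso_preserves_M3_edges)
qed

lemma induced_iso_imp_edge_iso:
  assumes "induced_iso V E U U' h"
  shows "edge_iso E E U U' h"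
  unfolding edge_iso_def
proof (intro conjI ballI impI)
  show "bij_betw h U U'" using assms unfolding induced_iso_def by blast
  fix x y z assume "x \<in> U" "y \<in> U" "z \<in> U"
  then have "{x, y, z} \<subseteq> U" by blast
  then have "{x, y, z} \<in> E \<longleftrightarrow> h ` {x, y, z} \<in> E"
    using assms unfolding induced_iso_def by blast
  then show "{x, y, z} \<in> E \<longleftrightarrow> {h x, h y, h z} \<in> E" by simp
qed

lemma hg_aut_edge_iso:
  assumes "hg_aut V E g" "U \<subseteq> V"
  shows "edge_iso E E U (g ` U) g"
proof -
  have "induced_iso V E V V g" using assms(1) unfolding hg_aut_def induced_iso_def by blast
  then show ?thesis using edge_iso_restrict[OF induced_iso_imp_edge_iso assms(2)] by blast
qed

context C_structure
begin

lemma hypergraph_E: "hypergraph 3 M E"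
  unfolding hypergraph_def M3_edges_def by auto

lemma set_homogeneous_E: "set_homogeneous M E"
  unfolding set_homogeneous_def t_set_homogeneous_def
proof (intro allI impI)
  fix t :: nat and U U'
  assume *: "U \<subseteq> M \<and> U' \<subseteq> M \<and> finite U \<and> finite U' \<and> card U = t \<and> card U' = t \<and> (\<exists>h. induced_iso M E U U' h)"
  then obtain h where h: "edge_iso E E U U' h" using induced_iso_imp_edge_iso by blast
  have U: "finite U" "U \<subseteq> M" "U' \<subseteq> M" using * by blast+
  then obtain p where p: "part_iso M C le M C le p" "Domain p = U" "Range p = U'"
    using edge_iso_imp_part_iso[OF U h] by (elim exE conjE)
  obtain g where g: "bij_betw g M M" "\<forall>x x'. (x, x') \<in> p \<longrightarrow> g x = x'"
    "\<forall>x\<in>M. \<forall>y\<in>M. lt x y \<longleftrightarrow> lt (g x) (g y)"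
    "\<forall>x\<in>M. \<forall>y\<in>M. \<forall>z\<in>M. C x y z \<longleftrightarrow> C (g x) (g y) (g z)"
    using part_iso_extends_to_iso[OF C_structure_axioms C_structure_axioms p(1)] .
  have "hg_aut M E g"
    unfolding hg_aut_def using g(1) iso_preserves_M3_edges[OF g(1,3,4)] by blast
  moreover have "g ` U = U'"
  proof -
    have "u \<in> U' \<longleftrightarrow> u \<in> g ` U" for u
      unfolding p(2,3)[symmetric] using g(2) by (auto simp: image_iff Domain_iff Range_iff)
    then show ?thesis by blast
  qed
  ultimately show "\<exists>g. hg_aut M E g \<and> g ` U = U'" by blast
qed

lemma hg_aut_lt:
  assumes "hg_aut M E g" "x \<in> M" "y \<in> M" "lt x y"
  shows "lt (g x) (g y)"
proof -
  have bij: "inj_on g M" "g ` M = M" using assms(1) by (auto simp: hg_aut_def bij_betw_def)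
  obtain c d where cd: "c \<in> M" "d \<in> M" "distinct [x, y, c, d]" "edge_split E {x, c, y, d} {x, c} {y, d}"
    using lt_iff_edge_split assms(2-4) lt_neq by metis
  have "{x, c, y, d} \<subseteq> M" using assms cd by blast
  from edge_split_image[OF cd(4) hg_aut_edge_iso[OF assms(1) this]]
  have "edge_split E {g x, g c, g y, g d} {g x, g c} {g y, g d}" by simp
  moreover have "distinct [g x, g y, g c, g d]"
    using cd assms(2,3) bij(1) by (auto simp: inj_on_def)
  moreover have "g x \<in> M" "g y \<in> M" "g c \<in> M" "g d \<in> M"
    using cd assms bij(2) by blast+
  ultimately show ?thesis using lt_iff_edge_split[of "g x" "g y"] by auto
qed

text \<open>Two-point sets carry no edges, so swapping two points is an isomorphism of induced
  subhypergraphs. Its failure to extend refutes homogeneity and 2-transitivity alike.\<close>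

lemma no_swap:
  obtains x y where "x \<in> M" "y \<in> M" "x \<noteq> y" "\<forall>g. hg_aut M E g \<longrightarrow> \<not> (g x = y \<and> g y = x)"
proof -
  obtain x y where "x \<in> M" "y \<in> M" "x \<noteq> y"
    using infinite_M by (metis finite.emptyI finite_insert finite_subset insertCI subsetI)
  then show thesis using that hg_aut_lt lt_cases lt_asym by metis
qed

lemma not_two_transitive_E: "\<not> aut_two_transitive M E"
proof
  assume "aut_two_transitive M E"
  moreover obtain x y where "x \<in> M" "y \<in> M" "x \<noteq> y" "\<forall>g. hg_aut M E g \<longrightarrow> \<not> (g x = y \<and> g y = x)"
    using no_swap .
  ultimately show False unfolding aut_two_transitive_def by metis
qed

lemma not_homogeneous_E: "\<not> homogeneous M E"
proof
  assume hom: "homogeneous M E"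
  obtain x y where xy: "x \<in> M" "y \<in> M" "x \<noteq> y" "\<forall>g. hg_aut M E g \<longrightarrow> \<not> (g x = y \<and> g y = x)"
    using no_swap .
  define h where "h u = (if u = x then y else x)" for u
  have "A \<notin> E" if "A \<subseteq> {x, y}" for A
  proof
    assume "A \<in> E"
    then have "card A = 3" using hypergraph_E unfolding hypergraph_def by blast
    moreover have "card A \<le> card {x, y}" using that by (simp add: card_mono)
    ultimately show False using xy by simp
  qed
  moreover have "h ` A \<subseteq> {x, y}" if "A \<subseteq> {x, y}" for A using that unfolding h_def by auto
  ultimately have "\<forall>A. A \<subseteq> {x, y} \<longrightarrow> (A \<in> E \<longleftrightarrow> h ` A \<in> E)" by blast
  moreover have "bij_betw h {x, y} {x, y}" using xy(3) by (auto simp: h_def bij_betw_def inj_on_def)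
  ultimately have "induced_iso M E {x, y} {x, y} h"
    using xy(1,2) unfolding induced_iso_def by simp
  then obtain g where "hg_aut M E g" "\<forall>u\<in>{x, y}. g u = h u"
    using hom[unfolded homogeneous_def, rule_format, of "{x, y}" "{x, y}" h] by auto
  then show False using xy unfolding h_def by auto
qed

end

section \<open>Set-homogeneous 3-hypergraphs with an invariant tournament\<close>

lemma hg_aut_comp: "\<lbrakk>hg_aut V E g; hg_aut V E h\<rbrakk> \<Longrightarrow> hg_aut V E (h \<circ> g)"
proof -
  assume g: "hg_aut V E g" and h: "hg_aut V E h"
  have "bij_betw (h \<circ> g) V V" using g h unfolding hg_aut_def by (blast intro: bij_betw_trans)
  moreover have "A \<in> E \<longleftrightarrow> (h \<circ> g) ` A \<in> E" if A: "A \<subseteq> V" for A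
  proof -
    have "g ` A \<subseteq> V" using A g unfolding hg_aut_def bij_betw_def by blast
    then have "g ` A \<in> E \<longleftrightarrow> h ` (g ` A) \<in> E" using h unfolding hg_aut_def by blast
    moreover have "A \<in> E \<longleftrightarrow> g ` A \<in> E" using A g unfolding hg_aut_def by blast
    ultimately show ?thesis by (simp add: image_comp)
  qed
  ultimately show ?thesis unfolding hg_aut_def by blast
qed

lemma hg_aut_inverse:
  assumes g: "hg_aut V E g"
  obtains h where "hg_aut V E h" "\<forall>x\<in>V. h (g x) = x"
proof -
  define h where "h = the_inv_into V g"
  have b: "bij_betw g V V" using g unfolding hg_aut_def by blast
  then have hg: "h (g x) = x" "g (h x) = x" if "x \<in> V" for x
    using that unfolding h_def bij_betw_def
    by (simp add: the_inv_into_f_f, simp add: f_the_inv_into_f)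
  have hV: "bij_betw h V V" unfolding h_def using b by (rule bij_betw_the_inv_into)
  have "A \<in> E \<longleftrightarrow> h ` A \<in> E" if A: "A \<subseteq> V" for A
  proof -
    have "h ` A \<subseteq> V" using A hV unfolding bij_betw_def by blast
    moreover have "g ` h ` A = A" using A hg(2) by (force simp: image_image)
    ultimately show ?thesis using g unfolding hg_aut_def by metis
  qed
  then show thesis using that[of h] hV hg(1) unfolding hg_aut_def by blast
qed

locale set_homogeneous_hypergraph =
  fixes V :: "'a set" and E :: "'a set set"
  assumes hypergraph: "hypergraph 3 V E" and countable_V: "countable V" and infinite_V: "infinite V"
    and set_hom: "le_set_homogeneous 4 V E"
begin

abbreviation aut where "aut \<equiv> hg_aut V E"

lemma edgeD: "A \<in> E \<Longrightarrow> A \<subseteq> V \<and> finite A \<and> card A = 3"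
  using hypergraph unfolding hypergraph_def by blast

lemma aut_V: "\<lbrakk>aut g; x \<in> V\<rbrakk> \<Longrightarrow> g x \<in> V"
  unfolding hg_aut_def bij_betw_def by blast

lemma aut_edge: "\<lbrakk>aut g; x \<in> V; y \<in> V; z \<in> V\<rbrakk> \<Longrightarrow> {g x, g y, g z} \<in> E \<longleftrightarrow> {x, y, z} \<in> E"
proof -
  assume g: "aut g" and xyz: "x \<in> V" "y \<in> V" "z \<in> V"
  have "\<forall>A. A \<subseteq> V \<longrightarrow> (A \<in> E \<longleftrightarrow> g ` A \<in> E)" using g unfolding hg_aut_def by blast
  from this[rule_format, of "{x, y, z}"] show ?thesis using xyz by simp
qed

lemma set_homogeneousD:
  assumes "induced_iso V E U U' h" "finite U" "1 \<le> card U" "card U \<le> 4"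
  obtains g where "aut g" "g ` U = U'"
proof -
  have "U \<subseteq> V" "U' \<subseteq> V" "bij_betw h U U'" using assms(1) unfolding induced_iso_def by blast+
  moreover have "finite U'" "card U' = card U"
    using calculation(3) assms(2) bij_betw_finite bij_betw_same_card by metis+
  moreover have "t_set_homogeneous (card U) V E"
    using set_hom assms(3,4) unfolding le_set_homogeneous_def by blast
  ultimately have "\<exists>g. aut g \<and> g ` U = U'"
    using assms(1,2) unfolding t_set_homogeneous_def by blast
  then show thesis using that by blast
qed

lemma pair_homogeneous:
  assumes "x \<in> V" "y \<in> V" "x \<noteq> y" "x' \<in> V" "y' \<in> V" "x' \<noteq> y'"
  obtains g where "aut g" "g x = x' \<and> g y = y' \<or> g x = y' \<and> g y = x'"
proof -
  define h where "h u = (if u = x then x' else y')" for u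
  have bij: "bij_betw h {x, y} {x', y'}" using assms by (auto simp: h_def bij_betw_def inj_on_def)
  have small: "A \<notin> E" if "A \<subseteq> {u, v}" for A u v
  proof
    assume "A \<in> E"
    then have "card A = 3" using edgeD by blast
    moreover have "card A \<le> card {u, v}" using that by (simp add: card_mono)
    moreover have "card {u, v} \<le> 2" by (simp add: card_insert_if)
    ultimately show False by simp
  qed
  have "A \<in> E \<longleftrightarrow> h ` A \<in> E" if "A \<subseteq> {x, y}" for A
  proof -
    have "h ` A \<subseteq> {x', y'}" using that bij unfolding bij_betw_def by blast
    then show ?thesis using small that by metis
  qed
  then have "induced_iso V E {x, y} {x', y'} h"
    unfolding induced_iso_def using assms bij by simp
  then obtain g where g: "aut g" "g ` {x, y} = {x', y'}"
    using set_homogeneousD[of "{x, y}" "{x', y'}" h] assms by auto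
  then have "g x = x' \<and> g y = y' \<or> g x = y' \<and> g y = x'" by (auto simp: doubleton_eq_iff)
  then show thesis using that g(1) by blast
qed

lemma triple_homogeneous:
  assumes "{x, y, z} \<subseteq> V" "{x', y', z'} \<subseteq> V" "distinct [x, y, z]" "distinct [x', y', z']"
    and "{x, y, z} \<in> E \<longleftrightarrow> {x', y', z'} \<in> E"
  obtains g where "aut g" "g ` {x, y, z} = {x', y', z'}"
proof -
  define h where "h u = (if u = x then x' else if u = y then y' else z')" for u
  have bij: "bij_betw h {x, y, z} {x', y', z'}"
    using assms(3,4) by (auto simp: h_def bij_betw_def inj_on_def)
  have "A \<in> E \<longleftrightarrow> h ` A \<in> E" if A: "A \<subseteq> {x, y, z}" for A
  proof (cases "A = {x, y, z}")
    case True
    then show ?thesis using assms(5) bij unfolding bij_betw_def by simp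
  next
    case False
    then have "A \<subset> {x, y, z}" using A by blast
    then have "card A < card {x, y, z}" by (simp add: psubset_card_mono)
    then have "card A < 3" using assms(3) by simp
    moreover have "finite A" using A finite_subset by blast
    ultimately show ?thesis using edgeD card_image_le[of A h] by fastforce
  qed
  then have "induced_iso V E {x, y, z} {x', y', z'} h"
    unfolding induced_iso_def using assms(1,2) bij by simp
  then show thesis
    using set_homogeneousD[of "{x, y, z}" "{x', y', z'}" h] assms(3) that by auto
qed

text \<open>A triple of a four-point set is named by the point it omits, so for such
  \<open>U\<close> this counts the edges inside \<open>U\<close>.\<close>

definition edge_count :: "'a set \<Rightarrow> nat" where
  "edge_count U = card {u \<in> U. U - {u} \<in> E}"

lemma edge_count_quad:
  assumes "distinct [a, b, c, d]"
  shows "edge_count {a, b, c, d} = of_bool ({b, c, d} \<in> E) + of_bool ({a, c, d} \<in> E) +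
    of_bool ({a, b, d} \<in> E) + of_bool ({a, b, c} \<in> E)"
proof -
  let ?U = "{a, b, c, d}"
  have "edge_count ?U = (\<Sum>u\<in>?U. of_bool (?U - {u} \<in> E))"
    unfolding edge_count_def by (simp add: sum.If_cases of_bool_def Int_def)
  also have "\<dots> = of_bool (?U - {a} \<in> E) + of_bool (?U - {b} \<in> E) + of_bool (?U - {c} \<in> E) + of_bool (?U - {d} \<in> E)"
    using assms by simp
  also have "?U - {a} = {b, c, d}" using assms by auto
  also have "?U - {b} = {a, c, d}" using assms by auto
  also have "?U - {c} = {a, b, d}" using assms by auto
  also have "?U - {d} = {a, b, c}" using assms by auto
  finally show ?thesis .
qed

text \<open>Any bijection that matches the points opposite to edges is an isomorphism, since it
  matches the opposite triples too. On four points the number of edges is thus a complete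
  invariant.\<close>

lemma quad_homogeneous:
  assumes "U \<subseteq> V" "U' \<subseteq> V" "card U = 4" "card U' = 4" "edge_count U = edge_count U'"
  obtains g where "aut g" "g ` U = U'"
proof -
  define B B' where "B = {u \<in> U. U - {u} \<in> E}" and "B' = {u \<in> U'. U' - {u} \<in> E}"
  have fin: "finite U" "finite U'" using assms(3,4) card.infinite by fastforce+
  have B: "B \<subseteq> U" "B' \<subseteq> U'" "card B = card B'"
    using assms(5) unfolding B_def B'_def edge_count_def by auto
  then have "card (U - B) = card (U' - B')"
    using assms(3,4) fin by (simp add: card_Diff_subset finite_subset)
  then obtain h1 h2 where h12: "bij_betw h1 B B'" "bij_betw h2 (U - B) (U' - B')"
    using finite_same_card_bij B fin by (metis finite_Diff finite_subset)
  define h where "h u = (if u \<in> B then h1 u else h2 u)" for u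
  have hB: "bij_betw h B B'" using h12(1) by (simp add: h_def cong: bij_betw_cong)
  moreover have "bij_betw h (U - B) (U' - B')" using h12(2) bij_betw_cong[of "U - B" h h2] by (simp add: h_def)
  ultimately have "bij_betw h (B \<union> (U - B)) (B' \<union> (U' - B'))"
    by (rule bij_betw_combine) blast
  then have bij: "bij_betw h U U'" using B by (simp add: Un_absorb1)
  then have inj: "inj_on h U" "h ` U = U'" unfolding bij_betw_def by auto
  have hBiff: "h u \<in> B' \<longleftrightarrow> u \<in> B" if "u \<in> U" for u
    using that hB inj B(1) unfolding bij_betw_def inj_on_def by blast
  have "A \<in> E \<longleftrightarrow> h ` A \<in> E" if A: "A \<subseteq> U" for A
  proof (cases "card A = 3")
    case True
    have "card (U - A) = 1" using True A assms(3) fin by (simp add: card_Diff_subset finite_subset)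
    then obtain u where u: "U - A = {u}" by (auto simp: card_1_singleton_iff)
    then have Au: "A = U - {u}" "u \<in> U" using A by blast+
    then have "h ` A = U' - {h u}" using inj inj_on_image_set_diff[of h U U "{u}"] by auto
    then show ?thesis
      using hBiff[OF Au(2)] Au inj unfolding B_def B'_def by auto
  next
    case False
    moreover have "card (h ` A) = card A" using inj(1) A by (meson card_image inj_on_subset)
    ultimately show ?thesis using edgeD by metis
  qed
  then have "induced_iso V E U U' h" unfolding induced_iso_def using assms(1,2) bij by simp
  then show thesis using set_homogeneousD[of U U' h thesis] fin assms(3) that by simp
qed

end

locale invariant_tournament = set_homogeneous_hypergraph V E
  for V :: "'a set" and E +
  fixes T :: "'a \<Rightarrow> 'a \<Rightarrow> bool"
  assumes T_V: "T x y \<Longrightarrow> x \<in> V \<and> y \<in> V"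
    and T_total: "\<lbrakk>x \<in> V; y \<in> V; x \<noteq> y\<rbrakk> \<Longrightarrow> T x y \<or> T y x"
    and T_asym: "T x y \<Longrightarrow> \<not> T y x"
    and T_aut: "\<lbrakk>hg_aut V E g; T x y\<rbrakk> \<Longrightarrow> T (g x) (g y)"
begin

lemma T_irrefl: "\<not> T x x"
  using T_asym by blast

lemma T_aut_iff: "\<lbrakk>aut g; x \<in> V; y \<in> V\<rbrakk> \<Longrightarrow> T (g x) (g y) \<longleftrightarrow> T x y"
  using T_aut T_total T_asym by metis

lemma arc_transitive:
  assumes "T x y" "T x' y'"
  obtains g where "aut g" "g x = x'" "g y = y'"
proof -
  obtain g where "aut g" "g x = x' \<and> g y = y' \<or> g x = y' \<and> g y = x'"
    using pair_homogeneous[of x y x' y'] T_V T_irrefl assms by metis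
  then show thesis using that T_aut T_asym assms by metis
qed

lemma converse_tournament: "invariant_tournament V E (\<lambda>x y. T y x)"
  by unfold_locales (use T_V T_total T_asym T_aut in blast)+

text \<open>If all triples had the same status, every permutation of \<open>V\<close> would be an
  automorphism, among them a transposition reversing an arc of \<open>T\<close>.\<close>

lemma mixed_triples:
  obtains A B where "A \<subseteq> V" "card A = 3" "A \<in> E" "B \<subseteq> V" "card B = 3" "B \<notin> E"
proof (rule ccontr)
  assume "\<not> thesis"
  then have uniform: "(A \<in> E \<longleftrightarrow> B \<in> E)" if "A \<subseteq> V" "card A = 3" "B \<subseteq> V" "card B = 3" for A B
    using that \<open>\<And>B A. \<lbrakk>A \<subseteq> V; card A = 3; A \<in> E; B \<subseteq> V; card B = 3; B \<notin> E\<rbrakk> \<Longrightarrow> thesis\<close> by blast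
  obtain x y where xy: "x \<in> V" "y \<in> V" "x \<noteq> y"
    using infinite_V by (metis finite.emptyI finite_insert finite_subset insertCI subsetI)
  define f where "f u = (if u = x then y else if u = y then x else u)" for u
  have bij: "bij_betw f V V" using xy by (auto simp: f_def bij_betw_def inj_on_def)
  have "A \<in> E \<longleftrightarrow> f ` A \<in> E" if A: "A \<subseteq> V" for A
  proof -
    have "card (f ` A) = card A" using bij A by (meson bij_betw_def card_image inj_on_subset)
    moreover have "f ` A \<subseteq> V" using bij A unfolding bij_betw_def by blast
    ultimately show ?thesis using uniform[of A "f ` A"] A edgeD by metis
  qed
  then have "hg_aut V E f" unfolding hg_aut_def using bij by blast
  moreover have "f x = y" "f y = x" using xy unfolding f_def by auto
  ultimately show False using T_aut T_asym T_total xy by metis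
qed

end

text \<open>\<open>T\<close> is the orbit of an ordered pair that no automorphism swaps; if all
  pairs could be swapped, the group would be 2-transitive. Homogeneity for pairs brings each pair
  into the orbit in some direction. If both directions occurred, composing with an inverse would
  swap the original pair.\<close>

lemma (in set_homogeneous_hypergraph) invariant_tournament_exists:
  assumes "\<not> aut_two_transitive V E"
  obtains T where "invariant_tournament V E T"
proof -
  have "\<exists>x0\<in>V. \<exists>y0\<in>V. x0 \<noteq> y0 \<and> (\<forall>g. aut g \<longrightarrow> \<not> (g x0 = y0 \<and> g y0 = x0))"
  proof (rule ccontr)
    assume "\<not> ?thesis"
    then have swap: "\<exists>g. aut g \<and> g x = y \<and> g y = x" if "x \<in> V" "y \<in> V" "x \<noteq> y" for x y
      using that by blast
    have "\<exists>g. aut g \<and> g x = x' \<and> g y = y'"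
      if xy: "x \<in> V" "y \<in> V" "x' \<in> V" "y' \<in> V" "x \<noteq> y" "x' \<noteq> y'" for x y x' y'
    proof -
      obtain g where g: "aut g" "g x = x' \<and> g y = y' \<or> g x = y' \<and> g y = x'"
        using pair_homogeneous[of x y x' y'] xy by metis
      obtain s where "aut s" "s y' = x'" "s x' = y'" using swap xy by metis
      then show ?thesis using g hg_aut_comp[of V E g s] by (metis comp_apply)
    qed
    then show False using assms unfolding aut_two_transitive_def by blast
  qed
  then obtain x0 y0 where xy0: "x0 \<in> V" "y0 \<in> V" "x0 \<noteq> y0" "\<forall>g. aut g \<longrightarrow> \<not> (g x0 = y0 \<and> g y0 = x0)"
    by blast
  define T where "T x y \<longleftrightarrow> (\<exists>g. aut g \<and> g x0 = x \<and> g y0 = y)" for x y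
  have "invariant_tournament V E T"
  proof (unfold_locales)
    show "x \<in> V \<and> y \<in> V" if "T x y" for x y
      using that xy0 aut_V unfolding T_def by blast
    show "T x y \<or> T y x" if "x \<in> V" "y \<in> V" "x \<noteq> y" for x y
      using pair_homogeneous[OF xy0(1-3) that] unfolding T_def by metis
    show "\<not> T y x" if "T x y" for x y
    proof
      assume "T y x"
      then obtain h where h: "aut h" "h x0 = y" "h y0 = x" unfolding T_def by blast
      obtain g where g: "aut g" "g x0 = x" "g y0 = y" using \<open>T x y\<close> unfolding T_def by blast
      obtain k where k: "aut k" "\<forall>x\<in>V. k (g x) = x" using hg_aut_inverse[OF g(1)] .
      have "(k \<circ> h) x0 = y0" "(k \<circ> h) y0 = x0" using h g k(2) xy0 by auto
      then show False using xy0(4) hg_aut_comp[OF h(1) k(1)] by blast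
    qed
    show "T (g x) (g y)" if "aut g" "T x y" for g x y
      using that hg_aut_comp unfolding T_def by (metis comp_apply)
  qed
  then show thesis by (rule that)
qed

section \<open>Invariant linear orders\<close>

text \<open>\<open>sorted_wrt\<close> compares every two entries, so different heads would dominate
  each other. This also applies to the linearly ordered triples of a tournament with
  3-cycles.\<close>

lemma sorted_wrt_asym_unique:
  assumes "\<And>x y. R x y \<Longrightarrow> \<not> R y x" "sorted_wrt R xs" "sorted_wrt R ys" "set xs = set ys"
  shows "xs = ys"
  using assms(2-4)
proof (induction xs arbitrary: ys)
  case (Cons x xs)
  then obtain y ys' where ys: "ys = y # ys'" by (cases ys) auto
  have irrefl: "\<not> R u u" for u using assms(1) by blast
  have "x = y"
  proof (rule ccontr)
    assume "x \<noteq> y"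
    then have "x \<in> set ys'" "y \<in> set xs" using Cons.prems(3) ys by auto
    then have "R y x" "R x y" using Cons.prems(1,2) ys by auto
    then show False using assms(1) by blast
  qed
  moreover have "x \<notin> set xs" "y \<notin> set ys'" using Cons.prems(1,2) ys irrefl by auto
  ultimately have "set xs = set ys'" using Cons.prems(3) ys by auto
  then show ?case using Cons ys \<open>x = y\<close> by simp
qed simp

context invariant_tournament
begin

text \<open>Upgrades set-homogeneity to pointwise control: preserving \<open>T\<close> leaves an
  automorphism no choice in how it matches two sorted sets.\<close>

lemma aut_sorted:
  assumes "aut g" "sorted_wrt T xs" "sorted_wrt T ys" "g ` set xs = set ys"
  shows "map g xs = ys"
proof (rule sorted_wrt_asym_unique[of T])
  show "sorted_wrt T (map g xs)"
    using assms(2) by (auto simp: sorted_wrt_map intro: sorted_wrt_mono_rel T_aut[OF assms(1)])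
qed (use assms T_asym in auto)

lemma sorted_triple_transitive:
  assumes "sorted_wrt T [x, y, z]" "sorted_wrt T [x', y', z']" "{x, y, z} \<in> E \<longleftrightarrow> {x', y', z'} \<in> E"
  obtains g where "aut g" "g x = x'" "g y = y'" "g z = z'"
proof -
  have "{x, y, z} \<subseteq> V" "{x', y', z'} \<subseteq> V" "distinct [x, y, z]" "distinct [x', y', z']"
    using assms(1,2) T_V T_irrefl by auto
  then obtain g where g: "aut g" "g ` {x, y, z} = {x', y', z'}"
    using triple_homogeneous assms(3) by metis
  then have "map g [x, y, z] = [x', y', z']" using aut_sorted[OF g(1) assms(1,2)] by simp
  then show thesis using that g(1) by simp
qed

lemma sorted_quad_unique:
  assumes "sorted_wrt T [a, b, c, d]" "sorted_wrt T [a', b', c', d']"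
    and "edge_count {a, b, c, d} = edge_count {a', b', c', d'}"
  shows "({b, c, d} \<in> E \<longleftrightarrow> {b', c', d'} \<in> E) \<and> ({a, c, d} \<in> E \<longleftrightarrow> {a', c', d'} \<in> E) \<and>
    ({a, b, d} \<in> E \<longleftrightarrow> {a', b', d'} \<in> E) \<and> ({a, b, c} \<in> E \<longleftrightarrow> {a', b', c'} \<in> E)"
proof -
  have dist: "distinct [a, b, c, d]" "distinct [a', b', c', d']"
    using assms(1,2) T_irrefl by auto
  have V: "{a, b, c, d} \<subseteq> V" "{a', b', c', d'} \<subseteq> V"
    using assms(1,2) T_V by auto
  have "card {a, b, c, d} = 4" "card {a', b', c', d'} = 4"
    using dist distinct_card[OF dist(1)] distinct_card[OF dist(2)] by simp_all
  then obtain g where g: "aut g" "g ` {a, b, c, d} = {a', b', c', d'}"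
    using quad_homogeneous[OF V _ _ assms(3)] by blast
  then have "map g [a, b, c, d] = [a', b', c', d']" using aut_sorted[OF g(1) assms(1,2)] by simp
  then show ?thesis using aut_edge[OF g(1)] V by auto
qed

end

locale invariant_order = invariant_tournament +
  assumes T_trans: "\<lbrakk>T x y; T y z\<rbrakk> \<Longrightarrow> T x z"
begin

lemma converse_order: "invariant_order V E (\<lambda>x y. T y x)"
proof -
  interpret conv: invariant_tournament V E "\<lambda>x y. T y x" by (rule converse_tournament)
  show ?thesis by unfold_locales (rule T_trans)
qed

lemma sort_triple:
  assumes "A \<subseteq> V" "card A = 3"
  obtains x y z where "A = {x, y, z}" "T x y" "T y z"
proof -
  obtain a b c where A: "A = {a, b, c}" "a \<noteq> b" "a \<noteq> c" "b \<noteq> c"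
    using assms(2) by (auto simp: card_3_iff)
  then have V: "a \<in> V" "b \<in> V" "c \<in> V" using assms(1) by auto
  have perm: "{a, c, b} = A" "{b, a, c} = A" "{b, c, a} = A" "{c, a, b} = A" "{c, b, a} = A"
    using A(1) by auto
  show thesis
    using T_total[OF V(1,2) A(2)] T_total[OF V(1,3) A(3)] T_total[OF V(2,3) A(4)] that A(1) perm
    by metis
qed

lemma triple_exists:
  obtains x y z where "T x y" "T y z" "{x, y, z} \<in> E \<longleftrightarrow> s"
proof -
  obtain A B where "A \<subseteq> V" "card A = 3" "A \<in> E" "B \<subseteq> V" "card B = 3" "B \<notin> E"
    using mixed_triples .
  then obtain A' where "A' \<subseteq> V" "card A' = 3" "A' \<in> E \<longleftrightarrow> s"
    by (cases s) blast+
  then show thesis using sort_triple that by metis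
qed

text \<open>All arcs are in one orbit, so a triple of either status can be moved until any chosen
  two of its points lie on the arc from \<open>x\<close> to \<open>y\<close>.\<close>

lemma pair_extend:
  assumes "T x y"
  shows "\<exists>w. T w x \<and> ({w, x, y} \<in> E \<longleftrightarrow> s)"
    and "\<exists>w. T x w \<and> T w y \<and> ({x, w, y} \<in> E \<longleftrightarrow> s)"
    and "\<exists>w. T y w \<and> ({x, y, w} \<in> E \<longleftrightarrow> s)"
proof -
  obtain a b c where abc: "T a b" "T b c" "{a, b, c} \<in> E \<longleftrightarrow> s" using triple_exists .
  then have V: "a \<in> V" "b \<in> V" "c \<in> V" "T a c" using T_V T_trans by blast+
  obtain g where g: "aut g" "g b = x" "g c = y" using arc_transitive[OF abc(2) assms] .
  show "\<exists>w. T w x \<and> ({w, x, y} \<in> E \<longleftrightarrow> s)"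
    using g T_aut[OF g(1) abc(1)] aut_edge[OF g(1) V(1-3)] abc(3) by metis
  obtain g where g: "aut g" "g a = x" "g c = y" using arc_transitive[OF V(4) assms] .
  show "\<exists>w. T x w \<and> T w y \<and> ({x, w, y} \<in> E \<longleftrightarrow> s)"
    using g T_aut[OF g(1) abc(1)] T_aut[OF g(1) abc(2)] aut_edge[OF g(1) V(1-3)] abc(3) by metis
  obtain g where g: "aut g" "g a = x" "g b = y" using arc_transitive[OF abc(1) assms] .
  show "\<exists>w. T y w \<and> ({x, y, w} \<in> E \<longleftrightarrow> s)"
    using g T_aut[OF g(1) abc(2)] aut_edge[OF g(1) V(1-3)] abc(3) by metis
qed

text \<open>The i-th argument tells whether the triple omitting the i-th of four sorted points is an edge.\<close>

definition pattern :: "bool \<Rightarrow> bool \<Rightarrow> bool \<Rightarrow> bool \<Rightarrow> bool" where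
  "pattern p1 p2 p3 p4 \<longleftrightarrow> (\<exists>a b c d. T a b \<and> T b c \<and> T c d \<and>
    ({b, c, d} \<in> E \<longleftrightarrow> p1) \<and> ({a, c, d} \<in> E \<longleftrightarrow> p2) \<and> ({a, b, d} \<in> E \<longleftrightarrow> p3) \<and> ({a, b, c} \<in> E \<longleftrightarrow> p4))"

lemma pattern_unique:
  assumes "pattern p1 p2 p3 p4" "pattern q1 q2 q3 q4"
    and "of_bool p1 + of_bool p2 + of_bool p3 + of_bool p4 = (of_bool q1 + of_bool q2 + of_bool q3 + of_bool q4 :: nat)"
  shows "p1 = q1 \<and> p2 = q2 \<and> p3 = q3 \<and> p4 = q4"
proof -
  obtain a b c d where p: "T a b" "T b c" "T c d"
    "{b, c, d} \<in> E \<longleftrightarrow> p1" "{a, c, d} \<in> E \<longleftrightarrow> p2" "{a, b, d} \<in> E \<longleftrightarrow> p3" "{a, b, c} \<in> E \<longleftrightarrow> p4"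
    using assms(1) unfolding pattern_def by blast
  obtain a' b' c' d' where q: "T a' b'" "T b' c'" "T c' d'"
    "{b', c', d'} \<in> E \<longleftrightarrow> q1" "{a', c', d'} \<in> E \<longleftrightarrow> q2" "{a', b', d'} \<in> E \<longleftrightarrow> q3" "{a', b', c'} \<in> E \<longleftrightarrow> q4"
    using assms(2) unfolding pattern_def by blast
  have sorted: "sorted_wrt T [a, b, c, d]" "sorted_wrt T [a', b', c', d']"
    using p(1-3) q(1-3) T_trans[OF p(1,2)] T_trans[OF p(2,3)] T_trans[OF q(1,2)] T_trans[OF q(2,3)]
      T_trans[OF T_trans[OF p(1,2)] p(3)] T_trans[OF T_trans[OF q(1,2)] q(3)] by simp_all
  then have dist: "distinct [a, b, c, d]" "distinct [a', b', c', d']" using T_irrefl by auto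
  have "edge_count {a, b, c, d} = edge_count {a', b', c', d'}"
    unfolding edge_count_quad[OF dist(1)] edge_count_quad[OF dist(2)] p(4-7) q(4-7) by (rule assms(3))
  from sorted_quad_unique[OF sorted this] show ?thesis unfolding p(4-7) q(4-7) .
qed

text \<open>Two triples sharing the pair \<open>x\<close>, \<open>y\<close> are prescribed
  independently. The two further points go into different gaps (left of, inside or right of the
  pair), so their mutual order is known although the two triples containing both are not. The three
  choices of gaps give this lemma and the next two.\<close>

lemma pattern_14: "\<exists>p q. pattern s p q t"
proof -
  obtain x y where xy: "T x y" using triple_exists by metis
  obtain a where a: "T a x" "{a, x, y} \<in> E \<longleftrightarrow> t" using pair_extend(1)[OF xy] by blast
  obtain d where d: "T y d" "{x, y, d} \<in> E \<longleftrightarrow> s" using pair_extend(3)[OF xy] by blast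
  show ?thesis unfolding pattern_def using xy a d by blast
qed

lemma pattern_13: "\<exists>p q. pattern s p t q"
proof -
  obtain x y where xy: "T x y" using triple_exists by metis
  obtain a where a: "T a x" "{a, x, y} \<in> E \<longleftrightarrow> t" using pair_extend(1)[OF xy] by blast
  obtain d where d: "T x d" "T d y" "{x, d, y} \<in> E \<longleftrightarrow> s" using pair_extend(2)[OF xy] by blast
  show ?thesis unfolding pattern_def using xy a d by blast
qed

lemma pattern_24: "\<exists>p q. pattern p s q t"
proof -
  obtain x y where xy: "T x y" using triple_exists by metis
  obtain a where a: "T x a" "T a y" "{x, a, y} \<in> E \<longleftrightarrow> t" using pair_extend(2)[OF xy] by blast
  obtain d where d: "T y d" "{x, y, d} \<in> E \<longleftrightarrow> s" using pair_extend(3)[OF xy] by blast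
  show ?thesis unfolding pattern_def using xy a d by blast
qed

end

text \<open>The patterns of the five plane binary trees with four leaves.\<close>

definition M3_pattern :: "bool \<Rightarrow> bool \<Rightarrow> bool \<Rightarrow> bool \<Rightarrow> bool" where
  "M3_pattern p1 p2 p3 p4 \<longleftrightarrow> (p1, p2, p3, p4) \<in>
    {(False, False, False, False), (False, False, False, True), (True, True, False, False),
     (False, True, True, True), (True, True, True, True)}"

text \<open>Abstracted to an arbitrary \<open>W\<close>, this is a propositional problem in the
  sixteen atoms \<open>W p1 p2 p3 p4\<close>. The lists \<open>u1\<close>, \<open>u2\<close>,
  \<open>u3\<close> hold the clashes between different patterns with one, two and three edges: 6, 15
  and 6 pairs.\<close>

lemma pattern_dichotomy:
  fixes W :: "bool \<Rightarrow> bool \<Rightarrow> bool \<Rightarrow> bool \<Rightarrow> bool"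
  assumes unique: "\<And>p1 p2 p3 p4 q1 q2 q3 q4. W p1 p2 p3 p4 \<Longrightarrow> W q1 q2 q3 q4 \<Longrightarrow>
      of_bool p1 + of_bool p2 + of_bool p3 + of_bool p4 =
        (of_bool q1 + of_bool q2 + of_bool q3 + of_bool q4 :: nat) \<Longrightarrow>
      p1 = q1 \<and> p2 = q2 \<and> p3 = q3 \<and> p4 = q4"
    and e14: "\<And>s t. \<exists>p q. W s p q t" and e13: "\<And>s t. \<exists>p q. W s p t q" and e24: "\<And>s t. \<exists>p q. W p s q t"
  shows "(\<forall>p1 p2 p3 p4. W p1 p2 p3 p4 \<longleftrightarrow> M3_pattern p1 p2 p3 p4) \<or>
    (\<forall>p1 p2 p3 p4. W p1 p2 p3 p4 \<longleftrightarrow> M3_pattern p4 p3 p2 p1)"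
proof -
  have differ: "\<not> (W p1 p2 p3 p4 \<and> W q1 q2 q3 q4)"
    if "of_bool p1 + of_bool p2 + of_bool p3 + of_bool p4 =
        (of_bool q1 + of_bool q2 + of_bool q3 + of_bool q4 :: nat)"
      "\<not> (p1 = q1 \<and> p2 = q2 \<and> p3 = q3 \<and> p4 = q4)" for p1 p2 p3 p4 q1 q2 q3 q4
    using unique that by blast
  have u1: "\<not> (W True False False False \<and> W False True False False)"
    "\<not> (W True False False False \<and> W False False True False)"
    "\<not> (W True False False False \<and> W False False False True)"
    "\<not> (W False True False False \<and> W False False True False)"
    "\<not> (W False True False False \<and> W False False False True)"
    "\<not> (W False False True False \<and> W False False False True)"
    by (rule differ; simp)+
  have u3: "\<not> (W False True True True \<and> W True False True True)"
    "\<not> (W False True True True \<and> W True True False True)"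
    "\<not> (W False True True True \<and> W True True True False)"
    "\<not> (W True False True True \<and> W True True False True)"
    "\<not> (W True False True True \<and> W True True True False)"
    "\<not> (W True True False True \<and> W True True True False)"
    by (rule differ; simp)+
  have u2: "\<not> (W True True False False \<and> W True False True False)"
    "\<not> (W True True False False \<and> W True False False True)"
    "\<not> (W True True False False \<and> W False True True False)"
    "\<not> (W True True False False \<and> W False True False True)"
    "\<not> (W True True False False \<and> W False False True True)"
    "\<not> (W True False True False \<and> W True False False True)"
    "\<not> (W True False True False \<and> W False True True False)"
    "\<not> (W True False True False \<and> W False True False True)"
    "\<not> (W True False True False \<and> W False False True True)"
    "\<not> (W True False False True \<and> W False True True False)"
    "\<not> (W True False False True \<and> W False True False True)"
    "\<not> (W True False False True \<and> W False False True True)"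
    "\<not> (W False True True False \<and> W False True False True)"
    "\<not> (W False True True False \<and> W False False True True)"
    "\<not> (W False True False True \<and> W False False True True)"
    by (rule differ; simp)+
  have e: "\<forall>s t. \<exists>p q. W s p q t" "\<forall>s t. \<exists>p q. W s p t q" "\<forall>s t. \<exists>p q. W p s q t"
    using e14 e13 e24 by blast+
  show ?thesis
    using u1 u2 u3 e unfolding M3_pattern_def all_bool_eq ex_bool_eq
    by simp sat
qed

section \<open>Reconstruction of the C-relation from the edges\<close>

locale M3_patterned_order = invariant_order +
  assumes pattern_iff: "pattern p1 p2 p3 p4 \<longleftrightarrow> M3_pattern p1 p2 p3 p4"
begin

text \<open>For sorted \<open>x\<close>, \<open>y\<close>, \<open>z\<close> in M3 exactly one of
  \<open>C x y z\<close> and \<open>C z x y\<close> holds, and the triple is an edge in the first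
  case only. So edges decide \<open>C\<close> when its first argument is leftmost, nonedges when it
  is rightmost, and a middle point never branches off first.\<close>

definition C_of :: "'a \<Rightarrow> 'a \<Rightarrow> 'a \<Rightarrow> bool" where
  "C_of x y z \<longleftrightarrow> x \<in> V \<and> y \<in> V \<and> z \<in> V \<and> x \<noteq> y \<and> x \<noteq> z \<and>
    (y = z \<or> T x y \<and> T x z \<and> {x, y, z} \<in> E \<or> T y x \<and> T z x \<and> {x, y, z} \<notin> E)"

definition le_of :: "'a \<Rightarrow> 'a \<Rightarrow> bool" where
  "le_of x y \<longleftrightarrow> x = y \<or> T x y"

lemma strict_le_of: "strict le_of x y \<longleftrightarrow> T x y"
  unfolding strict_def le_of_def using T_irrefl by blast

lemma four_points:
  assumes "T a b" "T b c" "T c d"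
  shows "M3_pattern ({b, c, d} \<in> E) ({a, c, d} \<in> E) ({a, b, d} \<in> E) ({a, b, c} \<in> E)"
proof -
  have "pattern ({b, c, d} \<in> E) ({a, c, d} \<in> E) ({a, b, d} \<in> E) ({a, b, c} \<in> E)"
    unfolding pattern_def using assms by (intro exI[of _ a] exI[of _ b] exI[of _ c] exI[of _ d]) simp
  then show ?thesis by (simp only: pattern_iff)
qed

lemma C_of_first:
  assumes "T x y" "T x z" "y \<noteq> z"
  shows "C_of x y z \<longleftrightarrow> {x, y, z} \<in> E"
proof -
  have "x \<in> V" "y \<in> V" "z \<in> V" "x \<noteq> y" "x \<noteq> z" "\<not> T y x" "\<not> T z x"
    using T_V[OF assms(1)] T_V[OF assms(2)] T_asym[OF assms(1)] T_asym[OF assms(2)] assms(1,2) by auto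
  then show ?thesis unfolding C_of_def using assms by simp
qed

lemma C_of_last:
  assumes "T y x" "T z x" "y \<noteq> z"
  shows "C_of x y z \<longleftrightarrow> {x, y, z} \<notin> E"
proof -
  have "x \<in> V" "y \<in> V" "z \<in> V" "x \<noteq> y" "x \<noteq> z" "\<not> T x y" "\<not> T x z"
    using T_V[OF assms(1)] T_V[OF assms(2)] T_asym[OF assms(1)] T_asym[OF assms(2)] assms(1,2) by auto
  then show ?thesis unfolding C_of_def using assms by simp
qed

lemma C_of_pair: "\<lbrakk>x \<in> V; y \<in> V; x \<noteq> y\<rbrakk> \<Longrightarrow> C_of x y y"
  unfolding C_of_def by blast

lemma C_of_sym: "C_of x y z \<Longrightarrow> C_of x z y"
  unfolding C_of_def by (auto simp: insert_commute)

lemma C_of_asym: "C_of x y z \<Longrightarrow> \<not> C_of y x z"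
  unfolding C_of_def using T_asym T_irrefl by (auto simp: insert_commute)

text \<open>The point \<open>w\<close> falls into one of four gaps, and in each the list of five
  patterns settles the claim. The second conjunct is, up to \<open>C_of_sym\<close>, the first with
  \<open>y\<close> and \<open>z\<close> interchanged: the axiom is not symmetric in these two, while
  here they are sorted.\<close>

lemma C_of_third_first:
  assumes "T x y" "T y z" "{x, y, z} \<in> E" "w \<in> V" "w \<notin> {x, y, z}"
  shows "(C_of x w z \<or> C_of w y z) \<and> (C_of x w y \<or> C_of w y z)"
proof -
  have V: "x \<in> V" "y \<in> V" "z \<in> V" and xz: "T x z" and yz: "y \<noteq> z" "z \<noteq> y"
    using T_V[OF assms(1)] T_V[OF assms(2)] T_trans[OF assms(1,2)] T_asym[OF assms(2)] assms(2) by auto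
  consider "T w x" | "T x w" "T w y" | "T y w" "T w z" | "T z w"
    using T_total V assms(4,5) by blast
  then show ?thesis
  proof cases
    case 1
    then have "T w y" "T w z" using assms(1) xz T_trans by blast+
    then show ?thesis
      using four_points[OF 1 assms(1,2)] yz assms(3) T_irrefl[of y] C_of_first[of w y z] assms(2)
      by (auto simp: M3_pattern_def)
  next
    case 2
    then have "T w z" using assms(2) T_trans by blast
    then show ?thesis
      using four_points[OF 2 assms(2)] yz assms C_of_first[of w y z] C_of_first[of x w z] C_of_first[of x w y] 2 xz
      by (auto simp: M3_pattern_def)
  next
    case 3
    then have "T x w" using assms(1) T_trans by blast
    then show ?thesis
      using four_points[OF assms(1) 3] yz assms C_of_first[of x w z] C_of_first[of x w y] C_of_last[of y z w] C_of_last[of y w z] 3 xz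
      by (auto simp: M3_pattern_def insert_commute)
  next
    case 4
    then have "T x w" "T y w" using assms(2) xz T_trans by blast+
    then show ?thesis
      using four_points[OF assms(1,2) 4] yz assms C_of_first[of x w z] C_of_first[of x w y] C_of_last[of y w z] 4 xz
      by (auto simp: M3_pattern_def insert_commute)
  qed
qed

lemma C_of_third_last:
  assumes "T y z" "T z x" "{x, y, z} \<notin> E" "w \<in> V" "w \<notin> {x, y, z}"
  shows "(C_of x w z \<or> C_of w y z) \<and> (C_of x w y \<or> C_of w y z)"
proof -
  have V: "x \<in> V" "y \<in> V" "z \<in> V" and yx: "T y x" and yz': "y \<noteq> z" "z \<noteq> y"
    using T_V[OF assms(1)] T_V[OF assms(2)] T_trans[OF assms(1,2)] T_asym[OF assms(1)] assms(1) by auto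
  have yzx: "{y, z, x} \<notin> E" using assms(3) by (simp add: insert_commute)
  consider "T w y" | "T y w" "T w z" | "T z w" "T w x" | "T x w"
    using T_total V assms(4,5) by blast
  then show ?thesis
  proof cases
    case 1
    then have "T w z" "T w x" using assms(1) yx T_trans by blast+
    then show ?thesis
      using four_points[OF 1 assms(1,2)] yzx yz' assms C_of_last[of w x z] C_of_last[of w x y] C_of_first[of w y z] 1 yx
      by (auto simp: M3_pattern_def insert_commute)
  next
    case 2
    then have "T w x" using assms(2) T_trans by blast
    then show ?thesis
      using four_points[OF 2 assms(2)] yzx yz' assms C_of_last[of w x z] C_of_last[of w x y] 2 yx
      by (auto simp: M3_pattern_def insert_commute)
  next
    case 3
    then have "T y w" using assms(1) T_trans by blast
    then show ?thesis
      using four_points[OF assms(1) 3] yzx yz' assms C_of_last[of w x z] C_of_last[of w x y] C_of_last[of y w z] 3 yx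
      by (auto simp: M3_pattern_def insert_commute)
  next
    case 4
    then have "T y w" "T z w" using assms(2) yx T_trans by blast+
    then show ?thesis
      using four_points[OF assms(1,2) 4] yzx yz' assms C_of_last[of y w z] 4 yx
      by (auto simp: M3_pattern_def insert_commute)
  qed
qed

lemma C_of_third:
  assumes "C_of x y z" "w \<in> V"
  shows "C_of x w z \<or> C_of w y z"
proof -
  have V: "x \<in> V" "y \<in> V" "z \<in> V" "x \<noteq> y" "x \<noteq> z" using assms(1) unfolding C_of_def by blast+
  consider "w \<in> {x, y, z}" | "y = z" "w \<notin> {x, y, z}"
    | "w \<notin> {x, y, z}" "T y z" | "w \<notin> {x, y, z}" "T z y"
    using T_total V by blast
  then show ?thesis
  proof cases
    case 3
    then show ?thesis
      using assms C_of_third_first[of x y z w] C_of_third_last[of y z x w] T_irrefl[of y] unfolding C_of_def[of x y z]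
      by blast
  next
    case 4
    then have "{x, z, y} = {x, y, z}" "w \<notin> {x, z, y}" by auto
    then show ?thesis
      using assms C_of_third_first[of x z y w] C_of_third_last[of z y x w] T_irrefl[of y] C_of_sym[of w z y] 4
      unfolding C_of_def[of x y z] by auto
  qed (use V assms C_of_pair in auto)
qed

lemma C_relation_C_of: "C_relation V C_of"
proof -
  have above: "\<exists>x\<in>V. C_of x y z" if yz: "y \<in> V" "z \<in> V" for y z
  proof -
    have ext: "\<exists>x\<in>V. C_of x y z" if "T y z" for y z
    proof -
      obtain x where "T x y" "{x, y, z} \<in> E \<longleftrightarrow> True" using pair_extend(1)[OF \<open>T y z\<close>] by blast
      then show ?thesis using C_of_first[of x y z] T_trans that T_irrefl T_V by metis
    qed
    obtain u where "u \<in> V" "u \<noteq> y"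
      using infinite_V by (metis finite.emptyI finite_insert finite_subset insertCI subsetI)
    then show ?thesis using ext T_total yz C_of_pair C_of_sym by metis
  qed
  have below: "\<exists>z\<in>V. y \<noteq> z \<and> C_of x y z" if xy: "x \<in> V" "y \<in> V" "x \<noteq> y" for x y
  proof (cases "T x y")
    case True
    obtain z where "T y z" "{x, y, z} \<in> E \<longleftrightarrow> True" using pair_extend(3)[OF True] by blast
    then show ?thesis using C_of_first[of x y z] T_trans True T_irrefl T_V by metis
  next
    case False
    then have yx: "T y x" using T_total xy by blast
    obtain z where z: "T z y" "{z, y, x} \<in> E \<longleftrightarrow> False" using pair_extend(1)[OF yx] by blast
    then have "{x, y, z} \<notin> E" by (simp add: insert_commute)
    then show ?thesis using z C_of_last[of y x z] T_trans yx T_irrefl T_V by metis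
  qed
  show ?thesis
    unfolding C_relation_def
    using C_of_sym C_of_asym C_of_third C_of_pair above below by meson
qed

lemma C_of_sorted:
  assumes "T x y" "T y z"
  shows "C_of x y z \<or> C_of z x y"
proof -
  have "T x z" "y \<noteq> z" "x \<noteq> y" using T_trans[OF assms] T_asym[OF assms(1)] T_asym[OF assms(2)] assms by auto
  moreover have "{z, x, y} = {x, y, z}" by auto
  ultimately show ?thesis
    using C_of_first[of x y z] C_of_last[of x z y] assms by simp
qed

lemma C_two_regular_C_of: "C_two_regular V C_of"
  unfolding C_two_regular_def
proof (intro ballI impI)
  fix x y z assume V: "x \<in> V" "y \<in> V" "z \<in> V" and "x \<noteq> y \<and> x \<noteq> z \<and> y \<noteq> z"
  then consider "T x y" "T y z" | "T x z" "T z y" | "T y x" "T x z" | "T y z" "T z x" | "T z x" "T x y" | "T z y" "T y x"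
    using T_total[OF V(1,2)] T_total[OF V(1,3)] T_total[OF V(2,3)] by blast
  then show "C_of x y z \<or> C_of y x z \<or> C_of z x y"
    by cases (use C_of_sorted C_of_sym in blast)+
qed

lemma compatible_C_of: "compatible_order V C_of le_of"
  unfolding compatible_order_def strict_le_of using C_of_sorted by blast

lemma total_order_le_of: "total_order_on V le_of"
  unfolding total_order_on_def le_of_def
proof (intro conjI ballI impI)
  show "x = y" if "(x = y \<or> T x y) \<and> (y = x \<or> T y x)" for x y using that T_asym by blast
  show "x = z \<or> T x z" if "(x = y \<or> T x y) \<and> (y = z \<or> T y z)" for x y z using that T_trans by blast
  show "(x = y \<or> T x y) \<or> (y = x \<or> T y x)" if "x \<in> V" "y \<in> V" for x y using T_total[OF that] by blast
qed simp

text \<open>\<open>C_of_third\<close> rests on the fact that only the listed patterns occur; strong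
  density rests on the other half of \<open>pattern_iff\<close>, that each of them does
  occur.\<close>

lemma M3_pattern_witness:
  assumes "M3_pattern p1 p2 p3 p4"
  obtains a b c d where "T a b" "T b c" "T c d" "T a c" "T b d" "T a d" "a \<in> V" "b \<in> V" "c \<in> V" "d \<in> V"
    "{b, c, d} \<in> E \<longleftrightarrow> p1" "{a, c, d} \<in> E \<longleftrightarrow> p2" "{a, b, d} \<in> E \<longleftrightarrow> p3" "{a, b, c} \<in> E \<longleftrightarrow> p4"
proof -
  obtain a b c d where w: "T a b" "T b c" "T c d"
    "{b, c, d} \<in> E \<longleftrightarrow> p1" "{a, c, d} \<in> E \<longleftrightarrow> p2" "{a, b, d} \<in> E \<longleftrightarrow> p3" "{a, b, c} \<in> E \<longleftrightarrow> p4"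
    using assms unfolding pattern_iff[symmetric] pattern_def by (elim exE conjE)
  have "T a c" "T b d" using T_trans[OF w(1,2)] T_trans[OF w(2,3)] .
  moreover have "T a d" using T_trans[OF w(1) \<open>T b d\<close>] .
  moreover have "a \<in> V" "b \<in> V" "c \<in> V" "d \<in> V" using w(1,3) T_V by blast+
  ultimately show thesis using that w by blast
qed

lemma triple_move:
  assumes "T a b" "T b c" "T x y" "T y z" "{a, b, c} \<in> E \<longleftrightarrow> {x, y, z} \<in> E"
  obtains g where "aut g" "g a = x" "g b = y" "g c = z"
proof -
  have "sorted_wrt T [a, b, c]" "sorted_wrt T [x, y, z]"
    using assms(1-4) T_trans[OF assms(1,2)] T_trans[OF assms(3,4)] by simp_all
  then show thesis using sorted_triple_transitive assms(5) that by metis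
qed

text \<open>In the all-\<open>True\<close> pattern every point branches off before all later ones,
  and its second point serves as \<open>w\<close>. In \<open>False True True True\<close> the last
  point branches off next after the first, and it serves as \<open>w\<close>. The other three points
  form an edge, so they can be moved onto \<open>x\<close>, \<open>y\<close>,
  \<open>z\<close>.\<close>

lemma dense_below_edge:
  assumes "T x y" "T y z" "{x, y, z} \<in> E"
  shows "\<exists>w. T x w \<and> T w y \<and> {w, y, z} \<in> E \<and> {x, y, w} \<in> E \<and> {x, z, w} \<in> E"
    and "\<exists>w. T z w \<and> {w, y, z} \<notin> E \<and> {x, y, w} \<in> E \<and> {x, z, w} \<in> E"
proof -
  obtain a b c d where w: "T a b" "T b c" "T c d" "T a c" "T b d" "T a d" "a \<in> V" "b \<in> V" "c \<in> V" "d \<in> V"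
    "{b, c, d} \<in> E \<longleftrightarrow> True" "{a, c, d} \<in> E \<longleftrightarrow> True" "{a, b, d} \<in> E \<longleftrightarrow> True" "{a, b, c} \<in> E \<longleftrightarrow> True"
    by (rule M3_pattern_witness[of True True True True]) (simp add: M3_pattern_def)
  obtain g where g: "aut g" "g a = x" "g c = y" "g d = z"
    using triple_move[OF w(4,3) assms(1,2)] w(12) assms(3) by blast
  show "\<exists>w. T x w \<and> T w y \<and> {w, y, z} \<in> E \<and> {x, y, w} \<in> E \<and> {x, z, w} \<in> E"
    using T_aut[OF g(1) w(1)] T_aut[OF g(1) w(2)] aut_edge[OF g(1) w(8-10)] aut_edge[OF g(1) w(7,8,9)]
      aut_edge[OF g(1) w(7,8,10)] g(2-4) w(11-14)
    by (intro exI[of _ "g b"]) (simp add: insert_commute)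
next
  obtain a b c d where w: "T a b" "T b c" "T c d" "T a c" "T b d" "T a d" "a \<in> V" "b \<in> V" "c \<in> V" "d \<in> V"
    "{b, c, d} \<in> E \<longleftrightarrow> False" "{a, c, d} \<in> E \<longleftrightarrow> True" "{a, b, d} \<in> E \<longleftrightarrow> True" "{a, b, c} \<in> E \<longleftrightarrow> True"
    by (rule M3_pattern_witness[of False True True True]) (simp add: M3_pattern_def)
  obtain g where g: "aut g" "g a = x" "g b = y" "g c = z"
    using triple_move[OF w(1,2) assms(1,2)] w(14) assms(3) by blast
  show "\<exists>w. T z w \<and> {w, y, z} \<notin> E \<and> {x, y, w} \<in> E \<and> {x, z, w} \<in> E"
    using T_aut[OF g(1) w(3)] aut_edge[OF g(1) w(8-10)] aut_edge[OF g(1) w(7,8,10)]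
      aut_edge[OF g(1) w(7,9,10)] g(2-4) w(11-14)
    by (intro exI[of _ "g d"]) (simp add: insert_commute)
qed

text \<open>Now \<open>x\<close> is rightmost. In \<open>False False False True\<close> the last
  point leaves first and the first point next, to the left of the other two; it serves as
  \<open>w\<close>. In the all-\<open>False\<close> pattern the points leave from right to left, and
  the third one serves as \<open>w\<close>.\<close>

lemma dense_below_nonedge:
  assumes "T y z" "T z x" "{x, y, z} \<notin> E"
  shows "\<exists>w. T w y \<and> {w, y, z} \<in> E \<and> {x, y, w} \<notin> E \<and> {x, z, w} \<notin> E"
    and "\<exists>w. T z w \<and> T w x \<and> {w, y, z} \<notin> E \<and> {x, y, w} \<notin> E \<and> {x, z, w} \<notin> E"
proof -
  have yzx: "{y, z, x} \<notin> E" using assms(3) by (simp add: insert_commute)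
  obtain a b c d where w: "T a b" "T b c" "T c d" "T a c" "T b d" "T a d" "a \<in> V" "b \<in> V" "c \<in> V" "d \<in> V"
    "{b, c, d} \<in> E \<longleftrightarrow> False" "{a, c, d} \<in> E \<longleftrightarrow> False" "{a, b, d} \<in> E \<longleftrightarrow> False" "{a, b, c} \<in> E \<longleftrightarrow> True"
    by (rule M3_pattern_witness[of False False False True]) (simp add: M3_pattern_def)
  obtain g where g: "aut g" "g b = y" "g c = z" "g d = x"
    using triple_move[OF w(2,3) assms(1,2)] w(11) yzx by blast
  show "\<exists>w. T w y \<and> {w, y, z} \<in> E \<and> {x, y, w} \<notin> E \<and> {x, z, w} \<notin> E"
    using T_aut[OF g(1) w(1)] aut_edge[OF g(1) w(7-9)] aut_edge[OF g(1) w(7,8,10)]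
      aut_edge[OF g(1) w(7,9,10)] g(2-4) w(11-14)
    by (intro exI[of _ "g a"]) (simp add: insert_commute)
next
  have yzx: "{y, z, x} \<notin> E" using assms(3) by (simp add: insert_commute)
  obtain a b c d where w: "T a b" "T b c" "T c d" "T a c" "T b d" "T a d" "a \<in> V" "b \<in> V" "c \<in> V" "d \<in> V"
    "{b, c, d} \<in> E \<longleftrightarrow> False" "{a, c, d} \<in> E \<longleftrightarrow> False" "{a, b, d} \<in> E \<longleftrightarrow> False" "{a, b, c} \<in> E \<longleftrightarrow> False"
    by (rule M3_pattern_witness[of False False False False]) (simp add: M3_pattern_def)
  obtain g where g: "aut g" "g a = y" "g b = z" "g d = x"
    using triple_move[OF w(1,5) assms(1,2)] w(13) yzx by blast
  show "\<exists>w. T z w \<and> T w x \<and> {w, y, z} \<notin> E \<and> {x, y, w} \<notin> E \<and> {x, z, w} \<notin> E"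
    using T_aut[OF g(1) w(2)] T_aut[OF g(1) w(3)] aut_edge[OF g(1) w(7-9)] aut_edge[OF g(1) w(7,9,10)]
      aut_edge[OF g(1) w(8-10)] g(2-4) w(11-14)
    by (intro exI[of _ "g c"]) (simp add: insert_commute)
qed

lemma C_of_dense_sorted:
  assumes "C_of x y z" "T y z"
  shows "(\<exists>w. C_of w y z \<and> C_of x y w \<and> C_of x z w \<and> T w y \<and> T w z) \<and>
    (\<exists>w. C_of w y z \<and> C_of x y w \<and> C_of x z w \<and> T y w \<and> T z w)"
proof -
  have yz: "y \<noteq> z" using assms(2) T_irrefl by blast
  then consider "T x y" "{x, y, z} \<in> E" | "T z x" "{x, y, z} \<notin> E"
    using assms(1) unfolding C_of_def by blast
  then show ?thesis
  proof cases
    case 1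
    have xz: "T x z" using 1 assms(2) T_trans by blast
    obtain w where w: "T x w" "T w y" "{w, y, z} \<in> E" "{x, y, w} \<in> E" "{x, z, w} \<in> E"
      using dense_below_edge(1)[OF 1(1) assms(2) 1(2)] by blast
    then have "T w z" "y \<noteq> w" "z \<noteq> w" using T_trans[OF w(2) assms(2)] T_irrefl by blast+
    then have A: "C_of w y z \<and> C_of x y w \<and> C_of x z w \<and> T w y \<and> T w z"
      using w C_of_first[of w y z] C_of_first[of x y w] C_of_first[of x z w] 1 xz yz by simp
    obtain v where v: "T z v" "{v, y, z} \<notin> E" "{x, y, v} \<in> E" "{x, z, v} \<in> E"
      using dense_below_edge(2)[OF 1(1) assms(2) 1(2)] by blast
    then have "T y v" "T x v" "y \<noteq> v" "z \<noteq> v" using T_trans[OF assms(2) v(1)] T_trans[OF xz v(1)] T_irrefl by blast+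
    then have "C_of v y z \<and> C_of x y v \<and> C_of x z v \<and> T y v \<and> T z v"
      using v C_of_last[of y v z] C_of_first[of x y v] C_of_first[of x z v] 1 xz yz by simp
    with A show ?thesis by blast
  next
    case 2
    have yx: "T y x" using 2 assms(2) T_trans by blast
    obtain w where w: "T w y" "{w, y, z} \<in> E" "{x, y, w} \<notin> E" "{x, z, w} \<notin> E"
      using dense_below_nonedge(1)[OF assms(2) 2] by blast
    then have "T w z" "T w x" "y \<noteq> w" "z \<noteq> w" using T_trans[OF w(1) assms(2)] T_trans[OF w(1) yx] T_irrefl by blast+
    then have A: "C_of w y z \<and> C_of x y w \<and> C_of x z w \<and> T w y \<and> T w z"
      using w C_of_first[of w y z] C_of_last[of y x w] C_of_last[of z x w] 2 yx yz by simp
    obtain v where v: "T z v" "T v x" "{v, y, z} \<notin> E" "{x, y, v} \<notin> E" "{x, z, v} \<notin> E"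
      using dense_below_nonedge(2)[OF assms(2) 2] by blast
    then have "T y v" "y \<noteq> v" "z \<noteq> v" using T_trans[OF assms(2) v(1)] T_irrefl by blast+
    then have "C_of v y z \<and> C_of x y v \<and> C_of x z v \<and> T y v \<and> T z v"
      using v C_of_last[of y v z] C_of_last[of y x v] C_of_last[of z x v] 2 yx yz by simp
    with A show ?thesis by blast
  qed
qed

text \<open>Strong density in the degenerate case \<open>y = z\<close> involves three points only,
  so \<open>pair_extend\<close> provides the witnesses.\<close>

lemma C_of_dense_pair:
  assumes "x \<in> V" "y \<in> V" "x \<noteq> y"
  shows "(\<exists>w. C_of w y y \<and> C_of x y w \<and> T w y) \<and> (\<exists>w. C_of w y y \<and> C_of x y w \<and> T y w)"
proof (cases "T x y")
  case True
  obtain w where w: "T x w" "T w y" "{x, w, y} \<in> E \<longleftrightarrow> True" using pair_extend(2)[OF True] by blast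
  have "y \<noteq> w" "w \<in> V" using w T_irrefl T_V by blast+
  then have A: "C_of w y y \<and> C_of x y w \<and> T w y"
    using w C_of_first[of x y w] C_of_pair[of w y] True assms by (simp add: insert_commute)
  obtain v where v: "T y v" "{x, y, v} \<in> E \<longleftrightarrow> True" using pair_extend(3)[OF True] by blast
  have "y \<noteq> v" "v \<in> V" "T x v" using v T_irrefl T_V T_trans[OF True] by blast+
  then have "C_of v y y \<and> C_of x y v \<and> T y v"
    using v C_of_first[of x y v] C_of_pair[of v y] True assms by (simp add: insert_commute)
  with A show ?thesis by blast
next
  case False
  then have yx: "T y x" using T_total assms by blast
  obtain w where w: "T w y" "{w, y, x} \<in> E \<longleftrightarrow> False" using pair_extend(1)[OF yx] by blast
  have "y \<noteq> w" "w \<in> V" "T w x" using w T_irrefl T_V T_trans[OF w(1) yx] by blast+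
  then have A: "C_of w y y \<and> C_of x y w \<and> T w y"
    using w C_of_last[of y x w] C_of_pair[of w y] yx assms by (simp add: insert_commute)
  obtain v where v: "T y v" "T v x" "{y, v, x} \<in> E \<longleftrightarrow> False" using pair_extend(2)[OF yx] by blast
  have "y \<noteq> v" "v \<in> V" using v T_irrefl T_V by blast+
  then have "C_of v y y \<and> C_of x y v \<and> T y v"
    using v C_of_last[of y x v] C_of_pair[of v y] yx assms by (simp add: insert_commute)
  with A show ?thesis by blast
qed

lemma strongly_dense_C_of: "strongly_dense V C_of le_of"
proof -
  have dense: "\<exists>z\<in>V. T x z \<and> T z y" if "T x y" for x y
    using pair_extend(2)[OF that] T_V by blast
  have unbounded: "(\<exists>y\<in>V. T x y) \<and> (\<exists>y\<in>V. T y x)" if x: "x \<in> V" for x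
  proof -
    obtain u where "u \<in> V" "u \<noteq> x"
      using infinite_V by (metis finite.emptyI finite_insert finite_subset insertCI subsetI)
    then consider "T x u" | "T u x" using T_total x by blast
    then show ?thesis using pair_extend(1,3) T_V by cases blast+
  qed
  have C8: "(\<exists>w\<in>V. C_of w y z \<and> C_of x y w \<and> T w y \<and> T w z) \<and> (\<exists>w\<in>V. C_of w y z \<and> C_of x y w \<and> T y w \<and> T z w)"
    if C: "C_of x y z" for x y z
  proof -
    have V: "x \<in> V" "y \<in> V" "z \<in> V" "x \<noteq> y" using C unfolding C_of_def by blast+
    consider "y = z" | "T y z" | "T z y" using T_total V by blast
    then show ?thesis
    proof cases
      case 1
      then show ?thesis using C_of_dense_pair[OF V(1,2,4)] T_V by blast
    next
      case 2
      then show ?thesis using C_of_dense_sorted[OF C 2] T_V by blast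
    next
      case 3
      then show ?thesis using C_of_dense_sorted[OF C_of_sym[OF C] 3] T_V C_of_sym[of _ z y] by blast
    qed
  qed
  show ?thesis
    unfolding strongly_dense_def strict_le_of using dense unbounded C8 by simp
qed

lemma M3_structure_C_of: "M3_structure V C_of le_of"
  unfolding M3_structure_def
  using countable_V infinite_V C_relation_C_of C_two_regular_C_of total_order_le_of compatible_C_of
    strongly_dense_C_of by blast

lemma M3_edges_C_of: "M3_edges V C_of le_of = E"
proof (intro set_eqI iffI)
  fix A assume "A \<in> M3_edges V C_of le_of"
  then obtain x y z where "A = {x, y, z}" "y \<noteq> z" "T x y" "T x z" "C_of x y z"
    unfolding M3_edges_def strict_le_of by blast
  then show "A \<in> E" using C_of_first by blast
next
  fix A assume A: "A \<in> E"
  then obtain x y z where xyz: "A = {x, y, z}" "T x y" "T y z" using sort_triple edgeD by metis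
  have "T x z" using T_trans[OF xyz(2,3)] .
  moreover have "x \<in> V" "y \<in> V" "z \<in> V" "x \<noteq> y" "y \<noteq> z" "x \<noteq> z"
    using T_V[OF xyz(2)] T_V[OF xyz(3)] T_irrefl calculation xyz by auto
  moreover have "C_of x y z" using C_of_first[of x y z] calculation xyz A by simp
  ultimately show "A \<in> M3_edges V C_of le_of"
    unfolding M3_edges_def strict_le_of using xyz by blast
qed

end

text \<open>Reversing \<open>T\<close> keeps the edges and reads every pattern backwards, so the
  mirrored list of patterns becomes that of M3.\<close>

lemma (in invariant_order) M3_structure_exists:
  obtains C le where "M3_structure V C le" "M3_edges V C le = E"
proof -
  interpret conv: invariant_order V E "\<lambda>x y. T y x" by (rule converse_order)
  have conv_pattern: "conv.pattern p1 p2 p3 p4 \<longleftrightarrow> pattern p4 p3 p2 p1" for p1 p2 p3 p4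
  proof -
    have rev: "{x, y, z} = {z, y, x}" for x y z :: 'a by auto
    show ?thesis
    proof
      assume "conv.pattern p1 p2 p3 p4"
      then obtain a b c d where "T b a" "T c b" "T d c" "{b, c, d} \<in> E \<longleftrightarrow> p1" "{a, c, d} \<in> E \<longleftrightarrow> p2"
        "{a, b, d} \<in> E \<longleftrightarrow> p3" "{a, b, c} \<in> E \<longleftrightarrow> p4"
        unfolding conv.pattern_def by (elim exE conjE)
      then show "pattern p4 p3 p2 p1"
        unfolding pattern_def
        by (intro exI[of _ d] exI[of _ c] exI[of _ b] exI[of _ a]) (simp add: rev[of d c b] rev[of d c a] rev[of d b a] rev[of c b a])
    next
      assume "pattern p4 p3 p2 p1"
      then obtain a b c d where "T a b" "T b c" "T c d" "{b, c, d} \<in> E \<longleftrightarrow> p4" "{a, c, d} \<in> E \<longleftrightarrow> p3"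
        "{a, b, d} \<in> E \<longleftrightarrow> p2" "{a, b, c} \<in> E \<longleftrightarrow> p1"
        unfolding pattern_def by (elim exE conjE)
      then show "conv.pattern p1 p2 p3 p4"
        unfolding conv.pattern_def
        by (intro exI[of _ d] exI[of _ c] exI[of _ b] exI[of _ a]) (simp add: rev[of d c b] rev[of d c a] rev[of d b a] rev[of c b a])
    qed
  qed
  consider "\<forall>p1 p2 p3 p4. pattern p1 p2 p3 p4 \<longleftrightarrow> M3_pattern p1 p2 p3 p4"
    | "\<forall>p1 p2 p3 p4. pattern p1 p2 p3 p4 \<longleftrightarrow> M3_pattern p4 p3 p2 p1"
    using pattern_dichotomy[of pattern, OF pattern_unique pattern_14 pattern_13 pattern_24] by blast
  then show thesis
  proof cases
    case 1
    then interpret M3_patterned_order V E T by unfold_locales blast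
    show thesis using that M3_structure_C_of M3_edges_C_of by blast
  next
    case 2
    then interpret pat: M3_patterned_order V E "\<lambda>x y. T y x"
      by unfold_locales (simp add: conv_pattern)
    show thesis using that pat.M3_structure_C_of pat.M3_edges_C_of by blast
  qed
qed

section \<open>Tournaments with 3-cycles\<close>

locale colored_dense_order =
  fixes A :: "'a set" and lt :: "'a \<Rightarrow> 'a \<Rightarrow> bool" and col :: "'a \<Rightarrow> bool"
  assumes countable: "countable A" and nonempty: "A \<noteq> {}"
    and asym: "\<lbrakk>x \<in> A; y \<in> A; lt x y\<rbrakk> \<Longrightarrow> \<not> lt y x"
    and total: "\<lbrakk>x \<in> A; y \<in> A; x \<noteq> y\<rbrakk> \<Longrightarrow> lt x y \<or> lt y x"
    and trans: "\<lbrakk>x \<in> A; y \<in> A; z \<in> A; lt x y; lt y z\<rbrakk> \<Longrightarrow> lt x z"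
    and between: "\<lbrakk>x \<in> A; y \<in> A; lt x y\<rbrakk> \<Longrightarrow> \<exists>w\<in>A. lt x w \<and> lt w y \<and> col w = k"
    and above: "x \<in> A \<Longrightarrow> \<exists>w\<in>A. lt x w \<and> col w = k"
    and below: "x \<in> A \<Longrightarrow> \<exists>w\<in>A. lt w x \<and> col w = k"
begin

text \<open>Together with the uniqueness of the countable order with two dense colours, this yields
  a bijection that reverses the order and exchanges the colours.\<close>

lemma reversed: "colored_dense_order A (\<lambda>x y. lt y x) (\<lambda>x. \<not> col x)"
proof
  show "\<exists>w\<in>A. lt w x \<and> lt y w \<and> (\<not> col w) = k" if "x \<in> A" "y \<in> A" "lt y x" for x y k
    using between[OF that(2,1,3), of "\<not> k"] by auto
  show "\<exists>w\<in>A. lt w x \<and> (\<not> col w) = k" if "x \<in> A" for x k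
    using below[OF that, of "\<not> k"] by auto
  show "\<exists>w\<in>A. lt x w \<and> (\<not> col w) = k" if "x \<in> A" for x k
    using above[OF that, of "\<not> k"] by auto
  show "lt z x" if "x \<in> A" "y \<in> A" "z \<in> A" "lt y x" "lt z y" for x y z
    using trans that by blast
qed (use countable nonempty asym total in blast)+

lemma cut_exists:
  assumes "finite P" "finite Q" "P \<subseteq> A" "Q \<subseteq> A" "\<forall>x\<in>P. \<forall>y\<in>Q. lt x y"
  obtains b where "b \<in> A" "\<forall>x\<in>P. lt x b" "\<forall>y\<in>Q. lt b y" "col b = k"
proof -
  have max: "\<exists>m\<in>P. \<forall>x\<in>P. x = m \<or> lt x m" if "P \<noteq> {}"
  proof -
    have "\<exists>m\<in>P. \<forall>x\<in>P. \<not> lt m x"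
      using assms(1) that by (rule finite_maximal) (use asym trans assms(3) in blast)+
    then show ?thesis using total assms(3) by blast
  qed
  have min: "\<exists>m\<in>Q. \<forall>x\<in>Q. x = m \<or> lt m x" if "Q \<noteq> {}"
  proof -
    have "\<exists>m\<in>Q. \<forall>x\<in>Q. \<not> lt x m"
      using assms(2) that by (rule finite_maximal) (use asym trans assms(4) in blast)+
    then show ?thesis using total assms(4) by blast
  qed
  consider "P = {}" "Q = {}" | "P \<noteq> {}" "Q = {}" | "P = {}" "Q \<noteq> {}" | "P \<noteq> {}" "Q \<noteq> {}" by blast
  then show thesis
  proof cases
    case 1
    then show thesis using that nonempty above by blast
  next
    case 2
    then obtain m where m: "m \<in> P" "\<forall>x\<in>P. x = m \<or> lt x m" using max by blast
    then obtain b where b: "b \<in> A" "lt m b" "col b = k" using above assms(3) by blast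
    have "lt x b" if "x \<in> P" for x using trans[of x m b] m b that assms(3) by (cases "x = m") auto
    then show thesis using that b 2 by blast
  next
    case 3
    then obtain n where n: "n \<in> Q" "\<forall>x\<in>Q. x = n \<or> lt n x" using min by blast
    then obtain b where b: "b \<in> A" "lt b n" "col b = k" using below assms(4) by blast
    have "lt b x" if "x \<in> Q" for x using trans[of b n x] n b that assms(4) by (cases "x = n") auto
    then show thesis using that b 3 by blast
  next
    case 4
    then obtain m n where m: "m \<in> P" "\<forall>x\<in>P. x = m \<or> lt x m" and n: "n \<in> Q" "\<forall>x\<in>Q. x = n \<or> lt n x"
      using max min by blast
    then obtain b where b: "b \<in> A" "lt m b" "lt b n" "col b = k"
      using between[of m n k] assms(3-5) by blast
    have "lt x b" if "x \<in> P" for x using trans[of x m b] m b that assms(3) by (cases "x = m") auto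
    moreover have "lt b x" if "x \<in> Q" for x using trans[of b n x] n b that assms(4) by (cases "x = n") auto
    ultimately show thesis using that b by blast
  qed
qed

end

definition order_part_iso where
  "order_part_iso A lt col B lt' col' p \<longleftrightarrow> finite p \<and> p \<subseteq> A \<times> B \<and>
    (\<forall>x x' y y'. (x, x') \<in> p \<longrightarrow> (y, y') \<in> p \<longrightarrow> (x = y \<longleftrightarrow> x' = y') \<and> (lt x y \<longleftrightarrow> lt' x' y') \<and> (col x \<longleftrightarrow> col' x'))"

lemma order_part_iso_converse:
  "order_part_iso A lt col B lt' col' p \<Longrightarrow> order_part_iso B lt' col' A lt col (p\<inverse>)"
  unfolding order_part_iso_def by auto

lemma order_part_iso_extend:
  assumes "colored_dense_order A lt col" "colored_dense_order B lt' col'"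
    and "order_part_iso A lt col B lt' col' p" "a \<in> A"
  shows "\<exists>b. order_part_iso A lt col B lt' col' (insert (a, b) p)"
proof (cases "a \<in> Domain p")
  case True
  then show ?thesis using assms(3) by (metis Domain.cases insert_absorb)
next
  case False
  interpret A: colored_dense_order A lt col by fact
  interpret B: colored_dense_order B lt' col' by fact
  have p: "finite p" "p \<subseteq> A \<times> B" "\<And>x x' y y'. (x, x') \<in> p \<Longrightarrow> (y, y') \<in> p \<Longrightarrow> x = y \<longleftrightarrow> x' = y'"
    "\<And>x x' y y'. (x, x') \<in> p \<Longrightarrow> (y, y') \<in> p \<Longrightarrow> lt x y \<longleftrightarrow> lt' x' y'"
    "\<And>x x'. (x, x') \<in> p \<Longrightarrow> col x \<longleftrightarrow> col' x'"
    using assms(3) unfolding order_part_iso_def by blast+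
  define P Q where "P = {x'. \<exists>x. (x, x') \<in> p \<and> lt x a}" and "Q = {x'. \<exists>x. (x, x') \<in> p \<and> lt a x}"
  have PQ: "P \<subseteq> Range p" "Q \<subseteq> Range p" unfolding P_def Q_def by blast+
  then have fin: "finite P" "finite Q" using p(1) finite_Range finite_subset by metis+
  have sub: "P \<subseteq> B" "Q \<subseteq> B" using PQ p(2) by blast+
  have sep: "\<forall>x\<in>P. \<forall>y\<in>Q. lt' x y"
  proof (intro ballI)
    fix x' y' assume "x' \<in> P" "y' \<in> Q"
    then obtain x y where xy: "(x, x') \<in> p" "lt x a" "(y, y') \<in> p" "lt a y" unfolding P_def Q_def by blast
    then have "lt x y" using A.trans[of x a y] p(2) assms(4) by blast
    then show "lt' x' y'" using p(4) xy by blast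
  qed
  obtain b where b: "b \<in> B" "\<forall>x\<in>P. lt' x b" "\<forall>y\<in>Q. lt' b y" "col' b = col a"
    using B.cut_exists[OF fin sub sep] .
  have new: "(lt a y \<longleftrightarrow> lt' b y') \<and> (lt y a \<longleftrightarrow> lt' y' b) \<and> y \<noteq> a \<and> y' \<noteq> b" if y: "(y, y') \<in> p" for y y'
  proof -
    have m: "y \<in> A" "y' \<in> B" "y \<noteq> a" using y p(2) False by blast+
    then consider "lt a y" "\<not> lt y a" | "lt y a" "\<not> lt a y" using A.total[of y a] A.asym assms(4) by blast
    then show ?thesis
    proof cases
      case 1
      then have "lt' b y'" using b y unfolding Q_def by blast
      then show ?thesis using 1 m B.asym[of b y'] b(1) by auto
    next
      case 2
      then have "lt' y' b" using b y unfolding P_def by blast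
      then show ?thesis using 2 m B.asym[of y' b] b(1) by auto
    qed
  qed
  have irrefl: "\<not> lt a a" "\<not> lt' b b" using A.asym B.asym assms(4) b(1) by blast+
  have "order_part_iso A lt col B lt' col' (insert (a, b) p)"
    unfolding order_part_iso_def
  proof (intro conjI allI impI)
    show "finite (insert (a, b) p)" using p by simp
    show "insert (a, b) p \<subseteq> A \<times> B" using p assms b by simp
    fix x x' y y'
    assume xy: "(x, x') \<in> insert (a, b) p" "(y, y') \<in> insert (a, b) p"
    show "(x = y) = (x' = y')" using xy p(3)[of x x' y y'] new by auto
    show "lt x y = lt' x' y'" using xy p(4)[of x x' y y'] new irrefl by auto
    show "col x = col' x'" using xy p(5)[of x x'] b(4) by auto
  qed
  then show ?thesis by blast
qed

text \<open>Cantor's argument; a finite partial isomorphism extends because every cut between finite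
  sets contains points of both colours.\<close>

lemma colored_dense_orders_isomorphic:
  assumes "colored_dense_order A lt col" "colored_dense_order B lt' col'"
  obtains f where "bij_betw f A B" "\<forall>x\<in>A. \<forall>y\<in>A. lt x y \<longleftrightarrow> lt' (f x) (f y)" "\<forall>x\<in>A. col x \<longleftrightarrow> col' (f x)"
proof -
  define P where "P = Collect (order_part_iso A lt col B lt' col')"
  have extend: "\<exists>b. insert (a, b) q \<in> P" if "q \<in> P" "a \<in> A" for q a
    using order_part_iso_extend[OF assms] that unfolding P_def by blast
  have extend': "\<exists>a. insert (a, b) q \<in> P" if q: "q \<in> P" "b \<in> B" for q b
  proof -
    obtain a where "order_part_iso B lt' col' A lt col (insert (b, a) (q\<inverse>))"
      using order_part_iso_extend[OF assms(2,1) order_part_iso_converse] q unfolding P_def by blast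
    moreover have "(insert (b, a) (q\<inverse>))\<inverse> = insert (a, b) q" by auto
    ultimately show ?thesis using order_part_iso_converse unfolding P_def by fastforce
  qed
  obtain f where f: "bij_betw f A B"
    "\<And>S. finite S \<Longrightarrow> S \<subseteq> A \<Longrightarrow> \<exists>q\<in>P. {} \<subseteq> q \<and> (\<forall>x\<in>S. (x, f x) \<in> q)"
  proof (rule back_and_forth[of A B "{}" P])
    show "countable A" "countable B"
      using assms colored_dense_order.countable by blast+
  qed (use extend extend' in \<open>auto simp: P_def order_part_iso_def\<close>)
  have "(lt x y \<longleftrightarrow> lt' (f x) (f y)) \<and> (col x \<longleftrightarrow> col' (f x))" if xy: "x \<in> A" "y \<in> A" for x y
  proof -
    obtain q where "order_part_iso A lt col B lt' col' q" "(x, f x) \<in> q" "(y, f y) \<in> q"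
      using f(2)[of "{x, y}"] xy unfolding P_def by auto
    then show ?thesis unfolding order_part_iso_def by blast
  qed
  then show thesis using that[OF f(1)] by blast
qed

section \<open>Local structure of tournaments with 3-cycles\<close>

lemma (in set_homogeneous_hypergraph) fresh_vertex:
  assumes "finite F"
  obtains x where "x \<in> V" "x \<notin> F"
  using infinite_V assms by (meson finite_subset subsetI)

text \<open>Four points carry six arcs, so one of them dominates two others, and the arc between
  these completes the triple.\<close>

lemma (in invariant_tournament) linear_triple_exists:
  obtains p q r where "T p q" "T q r" "T p r"
proof -
  obtain v where v: "v \<in> V" using fresh_vertex[of "{}"] by auto
  obtain a where a: "a \<in> V" "a \<notin> {v}" using fresh_vertex[of "{v}"] by auto
  obtain b where b: "b \<in> V" "b \<notin> {v, a}" using fresh_vertex[of "{v, a}"] by auto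
  obtain c where c: "c \<in> V" "c \<notin> {v, a, b}" using fresh_vertex[of "{v, a, b}"] by auto
  have T: "T v a \<or> T a v" "T v b \<or> T b v" "T v c \<or> T c v" "T a b \<or> T b a" "T a c \<or> T c a" "T b c \<or> T c b"
    using T_total v a b c by auto
  then show thesis using that by metis
qed

locale cyclic_tournament = invariant_tournament +
  fixes s :: bool
  assumes cyclic_edge: "\<lbrakk>T x y; T y z; T z x\<rbrakk> \<Longrightarrow> {x, y, z} \<in> E \<longleftrightarrow> s"
    and linear_edge: "\<lbrakk>T x y; T y z; T x z\<rbrakk> \<Longrightarrow> {x, y, z} \<in> E \<longleftrightarrow> \<not> s"
    and cyclic_exists: "\<exists>x y z. T x y \<and> T y z \<and> T z x"
begin

lemma converse_cyclic: "cyclic_tournament V E (\<lambda>x y. T y x) s"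
proof -
  interpret conv: invariant_tournament V E "\<lambda>x y. T y x" by (rule converse_tournament)
  have rev: "{x, y, z} = {z, y, x}" for x y z :: 'a by auto
  show ?thesis
  proof
    show "{x, y, z} \<in> E \<longleftrightarrow> s" if "T y x" "T z y" "T x z" for x y z
      using cyclic_edge[OF that(2,1,3)] by (simp add: rev[of x y z])
    show "{x, y, z} \<in> E \<longleftrightarrow> \<not> s" if "T y x" "T z y" "T z x" for x y z
      using linear_edge[OF that(2,1,3)] by (simp add: rev[of x y z])
    show "\<exists>x y z. T y x \<and> T z y \<and> T x z" using cyclic_exists by blast
  qed
qed

text \<open>Both quadruples contain one 3-cycle and three linear triples, hence have equally many
  edges and lie in one orbit. But the automorphism would carry \<open>v\<close> to a vertex
  dominating the rest of the second quadruple, which has no such vertex.\<close>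

lemma source_sink_exclusive:
  assumes "T v a" "T v b" "T v c" "T a b" "T b c" "T c a"
    and "T a' v'" "T b' v'" "T c' v'" "T a' b'" "T b' c'" "T c' a'"
  shows False
proof -
  have dist: "distinct [v, a, b, c]" "distinct [v', a', b', c']"
    using assms T_irrefl T_asym by auto
  have V: "{v, a, b, c} \<subseteq> V" "{v', a', b', c'} \<subseteq> V" using assms T_V by auto
  have card: "card {v, a, b, c} = 4" "card {v', a', b', c'} = 4"
    using distinct_card[OF dist(1)] distinct_card[OF dist(2)] by simp_all
  have "{v, a, c} = {v, c, a}" "{v', a', b'} = {a', b', v'}" "{v', b', c'} = {b', c', v'}" "{v', a', c'} = {c', a', v'}"
    by auto
  then have "edge_count {v, a, b, c} = edge_count {v', a', b', c'}"
    unfolding edge_count_quad[OF dist(1)] edge_count_quad[OF dist(2)]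
    using cyclic_edge[OF assms(4-6)] cyclic_edge[OF assms(10-12)]
      linear_edge[OF assms(2,5,3)] linear_edge[OF assms(3,6,1)] linear_edge[OF assms(1,4,2)]
      linear_edge[OF assms(11,9,8)] linear_edge[OF assms(12,7,9)] linear_edge[OF assms(10,8,7)] by simp
  then obtain g where g: "aut g" "g ` {v, a, b, c} = {v', a', b', c'}"
    using quad_homogeneous[OF V card] by blast
  have out: "T (g v) (g u)" if "u \<in> {v, a, b, c}" "u \<noteq> v" for u
    using that T_aut[OF g(1)] assms(1-3) by auto
  have "T (g v) u" if u: "u \<in> {v', a', b', c'}" "u \<noteq> g v" for u
  proof -
    obtain w where "w \<in> {v, a, b, c}" "u = g w" using u(1) g(2) by blast
    then show ?thesis using out u(2) by blast
  qed
  moreover have "g v \<in> {v', a', b', c'}" using g(2) by blast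
  ultimately have "\<exists>x\<in>{v', a', b', c'}. \<forall>u\<in>{v', a', b', c'}. u \<noteq> x \<longrightarrow> T x u" by blast
  then show False using assms(7-12) T_asym dist(2) by (auto; metis)
qed

text \<open>By \<open>source_sink_exclusive\<close> no 3-cycle dominates a vertex, and this forces
  \<open>T\<close> to be transitive. Given arcs from \<open>w\<close> to \<open>z\<close> and from
  \<open>z\<close> to \<open>a'\<close>, arc-transitivity makes \<open>z\<close> dominate a 3-cycle
  through \<open>a'\<close>.\<close>

lemma no_source:
  assumes "T v a" "T v b" "T v c" "T a b" "T b c" "T c a"
  shows False
proof -
  have no_sink: False if "T a' v'" "T b' v'" "T c' v'" "T a' b'" "T b' c'" "T c' a'" for v' a' b' c'
    using source_sink_exclusive[OF assms that] .
  have tr: "T w a'" if wz: "T w z" "T z a'" for w z a'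
  proof (rule ccontr)
    obtain g where g: "aut g" "g v = z" "g a = a'" using arc_transitive[OF assms(1) wz(2)] .
    define b' c' where "b' = g b" and "c' = g c"
    have z: "T z b'" "T z c'" "T a' b'" "T b' c'" "T c' a'"
      using T_aut[OF g(1)] assms g unfolding b'_def c'_def by metis+
    \<comment> \<open>If \<open>T q w\<close> held, then \<open>z\<close>, \<open>q\<close>,
      \<open>w\<close> would be a 3-cycle dominating \<open>p\<close>. So beating one point of the
      cycle spreads backwards around it; a \<open>w\<close> that does not beat \<open>a'\<close>
      beats none of the three and is dominated by the cycle.\<close>
    have step: "T w p \<Longrightarrow> T w q" if "T z p" "T z q" "T q p" for p q
      using no_sink[of z p q w] wz that T_total[of w q] T_V T_asym by metis
    assume "\<not> T w a'"
    then have "\<not> T w b'" "\<not> T w c'" using step[of b' a'] step[of c' b'] z wz by blast+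
    then have "T a' w" "T b' w" "T c' w"
      using \<open>\<not> T w a'\<close> T_total wz z T_V T_asym by metis+
    then show False using no_sink z by blast
  qed
  obtain x y z where "T x y" "T y z" "T z x" using cyclic_exists by blast
  then show False using tr T_asym by blast
qed

lemma no_sink:
  assumes "T a v" "T b v" "T c v" "T a b" "T b c" "T c a"
  shows False
proof -
  interpret conv: cyclic_tournament V E "\<lambda>x y. T y x" s by (rule converse_cyclic)
  show False using conv.no_source[of a v c b] assms by blast
qed

lemma linear_triple_transitive:
  assumes "T p q" "T q r" "T p r" "T p' q'" "T q' r'" "T p' r'"
  obtains g where "aut g" "g p = p'" "g q = q'" "g r = r'"
proof -
  have "sorted_wrt T [p, q, r]" "sorted_wrt T [p', q', r']" using assms by auto
  then show thesis
    using sorted_triple_transitive linear_edge[OF assms(1-3)] linear_edge[OF assms(4-6)] that by metis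
qed

lemma arc_extend:
  assumes "T x y"
  shows "\<exists>w. T x w \<and> T y w" "\<exists>w. T w x \<and> T w y" "\<exists>w. T x w \<and> T w y" "\<exists>w. T y w \<and> T w x"
proof -
  obtain p q r where l: "T p q" "T q r" "T p r" using linear_triple_exists .
  obtain a b c where c: "T a b" "T b c" "T c a" using cyclic_exists by blast
  obtain g where "aut g" "g p = x" "g q = y" using arc_transitive[OF l(1) assms] .
  then show "\<exists>w. T x w \<and> T y w" using T_aut[of g p r] T_aut[of g q r] l by auto
  obtain g where "aut g" "g q = x" "g r = y" using arc_transitive[OF l(2) assms] .
  then show "\<exists>w. T w x \<and> T w y" using T_aut[of g p q] T_aut[of g p r] l by auto
  obtain g where "aut g" "g p = x" "g r = y" using arc_transitive[OF l(3) assms] .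
  then show "\<exists>w. T x w \<and> T w y" using T_aut[of g p q] T_aut[of g q r] l by auto
  obtain g where "aut g" "g a = x" "g b = y" using arc_transitive[OF c(1) assms] .
  then show "\<exists>w. T y w \<and> T w x" using T_aut[of g b c] T_aut[of g c a] c by auto
qed

lemma chain_exists:
  obtains a b c d where "T a b" "T a c" "T a d" "T b c" "T b d" "T c d"
proof -
  obtain a d where ad: "T a d" using linear_triple_exists by metis
  obtain b where b: "T a b" "T b d" using arc_extend(3)[OF ad] by blast
  obtain c where c: "T b c" "T c d" using arc_extend(3)[OF b(2)] by blast
  \<comment> \<open>Otherwise \<open>a\<close>, \<open>b\<close>, \<open>c\<close> would form a
    3-cycle dominating \<open>d\<close>.\<close>
  have "T a c"
    using no_sink[OF ad b(2) c(2) b(1) c(1)] T_total[of a c] T_V ad c T_asym b by blast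
  then show thesis using that ad b c by blast
qed

lemma strong_quad_exists:
  obtains a b c d where "T a b" "T b c" "T c d" "T d a" "T a c" "T b d"
proof -
  obtain x y z where c: "T x y" "T y z" "T z x" using cyclic_exists by blast
  obtain w where w: "w \<in> V" "w \<notin> {x, y, z}" using fresh_vertex[of "{x, y, z}"] by auto
  have "T w x \<or> T x w" "T w y \<or> T y w" "T w z \<or> T z w" using T_total w T_V c by auto
  moreover have "\<not> (T w x \<and> T w y \<and> T w z)" "\<not> (T x w \<and> T y w \<and> T z w)"
    using no_source[of w x y z] no_sink[of x w y z] c by blast+
  ultimately show thesis using that c by metis
qed

text \<open>Linear triples share one status and so form one orbit; whatever occurs around one of
  them occurs around each. The first four extensions come from a chain of four vertices, the last
  two from a 4-cycle with its chords.\<close>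

lemma linear_triple_extend:
  assumes "T p q" "T q r" "T p r"
  shows "\<exists>w. T p w \<and> T q w \<and> T w r" "\<exists>w. T p w \<and> T w q \<and> T w r"
    "\<exists>w. T p w \<and> T q w \<and> T r w" "\<exists>w. T w p \<and> T w q \<and> T w r"
    "\<exists>w. T r w \<and> T w p \<and> T w q" "\<exists>w. T r w \<and> T w p \<and> T q w"
proof -
  obtain a b c d where l: "T a b" "T a c" "T a d" "T b c" "T b d" "T c d" using chain_exists .
  obtain g where "aut g" "g a = p" "g b = q" "g d = r" using linear_triple_transitive[OF l(1,5,3) assms] .
  then show "\<exists>w. T p w \<and> T q w \<and> T w r" using T_aut[of g] l by metis
  obtain g where "aut g" "g a = p" "g c = q" "g d = r" using linear_triple_transitive[OF l(2,6,3) assms] .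
  then show "\<exists>w. T p w \<and> T w q \<and> T w r" using T_aut[of g] l by metis
  obtain g where "aut g" "g a = p" "g b = q" "g c = r" using linear_triple_transitive[OF l(1,4,2) assms] .
  then show "\<exists>w. T p w \<and> T q w \<and> T r w" using T_aut[of g] l by metis
  obtain g where "aut g" "g b = p" "g c = q" "g d = r" using linear_triple_transitive[OF l(4,6,5) assms] .
  then show "\<exists>w. T w p \<and> T w q \<and> T w r" using T_aut[of g] l by metis
next
  obtain a b c d where t: "T a b" "T b c" "T c d" "T d a" "T a c" "T b d" using strong_quad_exists .
  obtain g where "aut g" "g b = p" "g c = q" "g d = r" using linear_triple_transitive[OF t(2,3,6) assms] .
  then show "\<exists>w. T r w \<and> T w p \<and> T w q" using T_aut[of g] t by metis
  obtain g where "aut g" "g a = p" "g b = q" "g c = r" using linear_triple_transitive[OF t(1,2,5) assms] .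
  then show "\<exists>w. T r w \<and> T w p \<and> T q w" using T_aut[of g] t by metis
qed

text \<open>Both neighbourhoods of a vertex v are linearly ordered, as for the points of a circle
  without antipodal pairs. Moving one of them to the antipodes yields a linear order on the other
  vertices, from which the tournament is recovered by means of the colouring T v.\<close>

definition lt_from :: "'a \<Rightarrow> 'a \<Rightarrow> 'a \<Rightarrow> bool" where
  "lt_from v x y \<longleftrightarrow> (if T v x \<longleftrightarrow> T v y then T x y else T y x)"

context
  fixes v assumes v: "v \<in> V"
begin

lemma side: "x \<in> V - {v} \<Longrightarrow> \<not> T v x \<longleftrightarrow> T x v"
  using T_total T_asym v by blast

lemma lt_from_asym: "\<lbrakk>x \<in> V - {v}; y \<in> V - {v}; lt_from v x y\<rbrakk> \<Longrightarrow> \<not> lt_from v y x"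
  unfolding lt_from_def using T_asym by metis

lemma lt_from_total: "\<lbrakk>x \<in> V - {v}; y \<in> V - {v}; x \<noteq> y\<rbrakk> \<Longrightarrow> lt_from v x y \<or> lt_from v y x"
  unfolding lt_from_def using T_total[of x y] by auto

text \<open>Suppose \<open>lt_from v\<close> had a 3-cycle. If its points lie on one side of
  \<open>v\<close>, it is a 3-cycle of \<open>T\<close> dominating \<open>v\<close> or dominated by
  it. If one point is alone on its side, then \<open>v\<close>, that point and one of the others
  form a 3-cycle dominating the remaining point or dominated by it.\<close>

lemma lt_from_trans:
  assumes "x \<in> V - {v}" "y \<in> V - {v}" "z \<in> V - {v}" "lt_from v x y" "lt_from v y z"
  shows "lt_from v x z"
proof (rule ccontr)
  assume "\<not> lt_from v x z"
  moreover have "x \<noteq> z" using lt_from_asym assms by blast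
  ultimately have zx: "lt_from v z x" using lt_from_total assms by blast
  note s = side[OF assms(1)] side[OF assms(2)] side[OF assms(3)]
  show False
    using assms(4,5) zx s
      no_source[of v x y z] no_sink[of x v y z]
      no_sink[of v y x z] no_sink[of v x z y] no_sink[of v z y x]
      no_source[of x v z y] no_source[of z v y x] no_source[of y v x z]
    unfolding lt_from_def by (auto split: if_splits)
qed

lemma lt_from_between:
  assumes "x \<in> V - {v}" "y \<in> V - {v}" "lt_from v x y"
  shows "\<exists>w\<in>V - {v}. lt_from v x w \<and> lt_from v w y \<and> T v w = k"
proof -
  note s = side[OF assms(1)] side[OF assms(2)]
  have red: ?thesis if ex: "\<exists>w. w \<noteq> v \<and> (T w v \<longleftrightarrow> \<not> k) \<and> (T v w \<longleftrightarrow> k) \<and> lt_from v x w \<and> lt_from v w y"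
  proof -
    obtain w where w: "w \<noteq> v" "T w v \<longleftrightarrow> \<not> k" "T v w \<longleftrightarrow> k" "lt_from v x w" "lt_from v w y" using ex by blast
    then have "w \<in> V" using T_V by (cases k) blast+
    then show ?thesis using w by blast
  qed
  consider (pp) "T v x" "T v y" "T x y" | (nn) "T x v" "T y v" "T x y"
    | (np) "T x v" "T v y" "T y x" | (pn) "T v x" "T y v" "T y x"
    using assms(3) s T_asym unfolding lt_from_def by metis
  then show ?thesis
  proof cases
    case pp
    then show ?thesis
      using linear_triple_extend(1)[OF pp(1,3,2)] linear_triple_extend(5)[OF pp(1,3,2)] T_asym T_irrefl
      by (intro red) (cases k; simp add: lt_from_def; metis)
  next
    case nn
    then show ?thesis
      using linear_triple_extend(2)[OF nn(3,2,1)] linear_triple_extend(6)[OF nn(3,2,1)] T_asym T_irrefl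
      by (intro red) (cases k; simp add: lt_from_def; metis)
  next
    case np
    \<comment> \<open>Here \<open>v\<close>, \<open>y\<close>, \<open>x\<close> form a 3-cycle. A
      vertex \<open>w\<close> dominated by \<open>x\<close> and \<open>y\<close> must beat
      \<open>v\<close>, as otherwise the whole cycle would dominate it; dually a vertex
      \<open>u\<close> dominating \<open>x\<close> and \<open>y\<close> is beaten by
      \<open>v\<close>. So both colours occur between \<open>x\<close> and \<open>y\<close>.\<close>
    obtain w where w: "T y w" "T x w" using arc_extend(1)[OF np(3)] by blast
    have "w \<noteq> v" using w np T_asym by blast
    then have wv: "T w v" using no_sink[of v w y x] w np T_total[of w v] T_V v by blast
    obtain u where u: "T u y" "T u x" using arc_extend(2)[OF np(3)] by blast
    have "u \<noteq> v" using u np T_asym by blast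
    then have vu: "T v u" using no_source[of u v y x] u np T_total[of u v] T_V v by blast
    show ?thesis
      using np w wv \<open>w \<noteq> v\<close> u vu \<open>u \<noteq> v\<close> T_asym
      by (intro red) (cases k; simp add: lt_from_def; metis)
  next
    case pn
    then show ?thesis
      using linear_triple_extend(3)[OF pn(2,1,3)] linear_triple_extend(4)[OF pn(2,1,3)] T_asym T_irrefl
      by (intro red) (cases k; simp add: lt_from_def; metis)
  qed
qed

lemma lt_from_unbounded:
  assumes "x \<in> V - {v}"
  shows "\<exists>w\<in>V - {v}. lt_from v x w \<and> T v w = k" "\<exists>w\<in>V - {v}. lt_from v w x \<and> T v w = k"
proof -
  have red: "\<exists>w\<in>V - {v}. P w \<and> T v w = k" if ex: "\<exists>w. (T w v \<longleftrightarrow> \<not> k) \<and> (T v w \<longleftrightarrow> k) \<and> P w" for P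
  proof -
    obtain w where w: "T w v \<longleftrightarrow> \<not> k" "T v w \<longleftrightarrow> k" "P w" using ex by blast
    then have "w \<in> V" "w \<noteq> v" using T_V T_irrefl by (cases k; blast)+
    then show ?thesis using w by blast
  qed
  consider "T v x" "\<not> T x v" | "T x v" "\<not> T v x" using side[OF assms] T_asym by blast
  then show "\<exists>w\<in>V - {v}. lt_from v x w \<and> T v w = k" "\<exists>w\<in>V - {v}. lt_from v w x \<and> T v w = k"
  proof (atomize(full), cases)
    case 1
    then show "(\<exists>w\<in>V - {v}. lt_from v x w \<and> T v w = k) \<and> (\<exists>w\<in>V - {v}. lt_from v w x \<and> T v w = k)"
      using arc_extend[OF 1(1)] T_asym
      by (intro conjI red) (cases k; simp add: lt_from_def; metis)+
  next
    case 2
    then show "(\<exists>w\<in>V - {v}. lt_from v x w \<and> T v w = k) \<and> (\<exists>w\<in>V - {v}. lt_from v w x \<and> T v w = k)"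
      using arc_extend[OF 2(1)] T_asym
      by (intro conjI red) (cases k; simp add: lt_from_def; metis)+
  qed
qed

lemma lt_from_dense: "colored_dense_order (V - {v}) (lt_from v) (T v)"
proof
  show "countable (V - {v})" using countable_V by simp
  show "V - {v} \<noteq> {}" using infinite_V by (metis finite.emptyI infinite_remove)
qed (fact lt_from_asym lt_from_total lt_from_trans lt_from_between lt_from_unbounded)+

text \<open>The bijection \<open>f\<close> of the coloured order reverses it and exchanges the
  colours. Exchanging the colours reverses the arcs at \<open>v\<close>. Whether two points have
  equal colours is unchanged, so reversing \<open>lt_from v\<close> reverses the arc between
  them.\<close>

lemma reversal_exists:
  obtains F where "bij_betw F V V" "\<forall>x\<in>V. \<forall>y\<in>V. T (F x) (F y) \<longleftrightarrow> T y x"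
proof -
  let ?A = "V - {v}"
  obtain f where f: "bij_betw f ?A ?A" "\<forall>x\<in>?A. \<forall>y\<in>?A. lt_from v x y \<longleftrightarrow> lt_from v (f y) (f x)"
    "\<forall>x\<in>?A. T v x \<longleftrightarrow> \<not> T v (f x)"
    using colored_dense_orders_isomorphic[OF lt_from_dense colored_dense_order.reversed[OF lt_from_dense]] .
  define F where "F x = (if x = v then v else f x)" for x
  have fA: "f x \<in> ?A" if "x \<in> ?A" for x using f(1) that unfolding bij_betw_def by blast
  have "bij_betw F ?A ?A" using f(1) bij_betw_cong[of ?A F f] by (simp add: F_def)
  moreover have "bij_betw F {v} {v}" by (simp add: F_def bij_betw_def)
  ultimately have "bij_betw F (?A \<union> {v}) (?A \<union> {v})" by (rule bij_betw_combine) blast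
  then have "bij_betw F V V" using v by (simp add: insert_absorb)
  moreover have "T (F x) (F y) \<longleftrightarrow> T y x" if xy: "x \<in> V" "y \<in> V" for x y
  proof -
    consider "x = y" | "x = v" "y \<in> ?A" | "y = v" "x \<in> ?A" | "x \<in> ?A" "y \<in> ?A" "x \<noteq> y" using xy by blast
    then show ?thesis
    proof cases
      case 1
      then show ?thesis using T_irrefl by simp
    next
      case 2
      then show ?thesis using f(3) side side[OF fA] T_asym unfolding F_def by auto
    next
      case 3
      then show ?thesis using f(3) side side[OF fA] T_asym unfolding F_def by auto
    next
      case 4
      have "f x \<noteq> f y" using 4 f(1) unfolding bij_betw_def inj_on_def by blast
      have "(lt_from v x y \<longleftrightarrow> lt_from v (f y) (f x)) \<and> (lt_from v y x \<longleftrightarrow> lt_from v (f x) (f y))"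
        "T v x \<longleftrightarrow> \<not> T v (f x)" "T v y \<longleftrightarrow> \<not> T v (f y)"
        using f(2,3) 4 by blast+
      then show ?thesis
        using 4 unfolding F_def lt_from_def by (auto split: if_splits)
    qed
  qed
  ultimately show thesis using that by blast
qed

end

text \<open>Reversing all arcs turns 3-cycles into 3-cycles and linear triples into linear triples,
  and the edges depend on this distinction alone.\<close>

lemma reversal_aut:
  assumes "bij_betw F V V" "\<forall>x\<in>V. \<forall>y\<in>V. T (F x) (F y) \<longleftrightarrow> T y x"
  shows "aut F"
proof -
  have "A \<in> E \<longleftrightarrow> F ` A \<in> E" if A: "A \<subseteq> V" for A
  proof (cases "card A = 3")
    case True
    then obtain x y z where xyz: "A = {x, y, z}" "x \<noteq> y" "x \<noteq> z" "y \<noteq> z" by (auto simp: card_3_iff)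
    have lin: ?thesis if l: "A = {a, b, c}" "T a b" "T b c" "T a c" for a b c
    proof -
      have "T (F c) (F b)" "T (F b) (F a)" "T (F c) (F a)" using l assms(2) A by auto
      moreover have "F ` A = {F c, F b, F a}" using l by auto
      ultimately show ?thesis using linear_edge l by metis
    qed
    have cyc: ?thesis if l: "A = {a, b, c}" "T a b" "T b c" "T c a" for a b c
    proof -
      have "T (F c) (F b)" "T (F b) (F a)" "T (F a) (F c)" using l assms(2) A by auto
      moreover have "F ` A = {F c, F b, F a}" using l by auto
      ultimately show ?thesis using cyclic_edge l by metis
    qed
    have perm: "A = {x, z, y}" "A = {y, x, z}" "A = {y, z, x}" "A = {z, x, y}" "A = {z, y, x}" using xyz(1) by auto
    have "T x y \<or> T y x" "T x z \<or> T z x" "T y z \<or> T z y" using T_total xyz A by auto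
    then show ?thesis using lin cyc xyz(1) perm by metis
  next
    case False
    moreover have "card (F ` A) = card A" using assms(1) A by (meson bij_betw_def card_image inj_on_subset)
    ultimately show ?thesis using edgeD by metis
  qed
  then show ?thesis unfolding hg_aut_def using assms(1) by blast
qed

lemma contradictory: False
proof -
  obtain x y z where c: "T x y" "T y z" "T z x" using cyclic_exists by blast
  then have V: "x \<in> V" "y \<in> V" using T_V by blast+
  obtain F where F: "bij_betw F V V" "\<forall>x\<in>V. \<forall>y\<in>V. T (F x) (F y) \<longleftrightarrow> T y x" using reversal_exists[OF V(1)] .
  show False using T_aut[OF reversal_aut[OF F] c(1)] F(2) V c(1) T_asym by blast
qed

end

text \<open>A 3-cycle and a linear triple cannot have the same status: every vertex of the cycle is
  beaten inside it, the first vertex of the linear triple is not. Hence the status of a given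
  3-cycle determines all edges and can serve as the parameter of
  \<open>cyclic_tournament\<close>.\<close>

lemma (in invariant_tournament) transitive: "\<lbrakk>T x y; T y z\<rbrakk> \<Longrightarrow> T x z"
proof (rule ccontr)
  assume "T x y" "T y z" "\<not> T x z"
  then have c: "T x y" "T y z" "T z x" using T_total T_V T_asym by metis+
  have differ: "{x, y, z} \<in> E \<longleftrightarrow> {a, b, c} \<notin> E" if c: "T x y" "T y z" "T z x" and l: "T a b" "T b c" "T a c" for x y z a b c
  proof (rule ccontr)
    assume "\<not> ?thesis"
    moreover have "{x, y, z} \<subseteq> V" "{a, b, c} \<subseteq> V" "distinct [x, y, z]" "distinct [a, b, c]"
      using c l T_V T_irrefl by auto
    ultimately obtain g where g: "aut g" "g ` {x, y, z} = {a, b, c}" using triple_homogeneous by metis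
    then have "a \<in> g ` {x, y, z}" by blast
    then obtain u where u: "u \<in> {x, y, z}" "g u = a" by blast
    obtain w where w: "w \<in> {x, y, z}" "T w u" using c u(1) by blast
    then have "T (g w) a" "g w \<in> {a, b, c}" using T_aut[OF g(1)] u g(2) by blast+
    then show False using l T_asym T_irrefl by blast
  qed
  obtain a b c where l: "T a b" "T b c" "T a c" using linear_triple_exists .
  interpret cyclic_tournament V E T "{x, y, z} \<in> E"
    by unfold_locales (use differ[OF _ _ _ l] differ[OF c] c in blast)+
  show False by (rule contradictory)
qed

section \<open>Properties and uniqueness of M3\<close>

theorem theoremA:
  fixes M :: "'a set" and C :: "'a \<Rightarrow> 'a \<Rightarrow> 'a \<Rightarrow> bool" and le :: "'a \<Rightarrow> 'a \<Rightarrow> bool"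
  assumes "M3_structure M C le"
  shows "hypergraph 3 M (M3_edges M C le) \<and> countable M \<and> infinite M \<and>
         set_homogeneous M (M3_edges M C le) \<and>
         \<not> homogeneous M (M3_edges M C le) \<and>
         \<not> aut_two_transitive M (M3_edges M C le) \<and>
         (\<forall>(V :: 'b set) E. hypergraph 3 V E \<and> countable V \<and> infinite V \<and>
             le_set_homogeneous 4 V E \<and> \<not> aut_two_transitive V E \<longrightarrow>
             hg_isomorphic V E M (M3_edges M C le))"
proof -
  interpret C_structure M C le by unfold_locales (fact assms)
  have unique: "hg_isomorphic V F M (M3_edges M C le)"
    if V: "hypergraph 3 V F" "countable V" "infinite V" "le_set_homogeneous 4 V F" "\<not> aut_two_transitive V F"
    for V :: "'b set" and F
  proof -
    interpret H: set_homogeneous_hypergraph V F using V(1-4) by unfold_locales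
    obtain T where "invariant_tournament V F T" using H.invariant_tournament_exists[OF V(5)] .
    then interpret T: invariant_tournament V F T .
    interpret T: invariant_order V F T by unfold_locales (rule T.transitive)
    obtain C' le' where *: "M3_structure V C' le'" "M3_edges V C' le' = F"
      using T.M3_structure_exists .
    have "C_structure V C' le'" using *(1) by unfold_locales
    from M3_structures_hg_isomorphic[OF this C_structure_axioms] show ?thesis unfolding *(2) .
  qed
  then show ?thesis
    using hypergraph_E countable_M infinite_M set_homogeneous_E not_homogeneous_E not_two_transitive_E by blast
qed

end
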